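(* Let $f_0\in\mathcal{Y}_2(B_1^m,\mathbb{Q})$ be strictly defined with $\mathrm{Dir}(f_0;B_1^m)<\infty$ and $\|\xi\circ f_0\|_{\mathcal{L}^2}<\infty$. For $h>0$ let $F_h:[0,\infty)\times B_1^m\to\mathbb{Q}$ be the function obtained by interpolating the step minimizing sequence $(f_h^k)_{k\ge0}$ starting at $f_0$ (defined in the context), write $F_k$ for $F_h$ with $h=1/2^k$, and let $F:[0,\infty)\times B_1^m\to\mathbb{Q}$ be a weak limit in $\mathcal{Y}_2$ (on $[0,T]\times B_1^m$ for every $T>0$) of a subsequence of $(F_k)$. Put $F_t(x)=F(t,x)$. Then for $\mathcal{L}^1$-almost every $t>0$, $$\mathrm{Dir}(F_t;B_1^m)\le\mathrm{Dir}(f_0;B_1^m).$$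
   Context: $\mathbb{Q}=\mathbb{Q}_Q(\mathbb{R}^n)$ is the set of unordered $Q$-tuples $\sum_{i=1}^Q[[p_i]]$ of points $p_i\in\mathbb{R}^n$ (repetitions allowed), with metric $\mathcal{G}(\sum_i[[p_i]],\sum_i[[q_i]])=\min_\sigma(\sum_i|p_i-q_{\sigma(i)}|^2)^{1/2}$ over permutations $\sigma$; $|\sum_i[[p_i]]|^2=\sum_i|p_i|^2$. $B_1^m=\{x\in\mathbb{R}^m:|x|\le1\}$. Embedding: for an orthogonal projection $\pi:\mathbb{R}^n\to\mathbb{R}$ let $\zeta(\pi,\sum_i[[p_i]])\in\mathbb{R}^Q$ be the nondecreasing rearrangement of $\pi(p_1),\dots,\pi(p_Q)$. Throughout, $\xi:\mathbb{Q}\to\mathbb{R}^{PQ}$ is a fixed map (White's modification of Almgren's embedding): a suitable positive multiple of the concatenation of $\zeta(\Pi_1,\cdot),\dots,\zeta(\Pi_P,\cdot)$, where $\Pi_1,\dots,\Pi_P$ are the complete sets of coordinate projections of finitely many orthonormal coordinate systems of $\mathbb{R}^n$, chosen so that $\xi$ is bi-Lipschitz onto its closed image $\mathbb{Q}^*=\xi(\mathbb{Q})$; moreover $|\xi(p)|=|p|$, and $|\xi(p)-\xi(q)|=\mathcal{G}(p,q)$ for $q$ sufficiently near $p$. Also fixed is a Lipschitz map $\rho:\mathbb{R}^{PQ}\to\mathbb{R}^{PQ}$ with $\rho(\mathbb{R}^{PQ})\subset\mathbb{Q}^*$ and $\rho(x)=x$ for $x\in\mathbb{Q}^*$ (such a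 map exists by Almgren). $\mathcal{Y}_2(A,V)$ ($V$ a Euclidean space) is the space of square summable functions $A\to V$ with square summable distributional first derivatives, and $\mathcal{Y}_2(A,\mathbb{Q})$ is the set of $f:A\to\mathbb{Q}$ with $\xi\circ f\in\mathcal{Y}_2(A,\mathbb{R}^{PQ})$. Weak convergence $u_k\rightharpoonup u$ in $\mathcal{Y}_2$ means $\xi\circ u_k\rightharpoonup\xi\circ u$ weakly in $W^{1,2}$. $\mathrm{Dir}(f;A)=\int_A|D(\xi_0\circ f)|^2=\int_A|D(\xi\circ f)|^2$, where $\xi_0$ is the concatenation of the maps $\zeta(x_i,\cdot)$ for the standard coordinate projections. A locally summable $V$-valued $f$ is strictly defined if $f(x)=y$ whenever the averages of $|f-y|$ over $B^m(x,r)$ tend to $0$ as $r\downarrow0$; a $\mathbb{Q}$-valued $f$ is strictly defined if $\xi\circ f$ is. Boundary values: $f\in\mathcal{Y}_2(B_1^m,V)$ has boundary values $g:\partial B_1^m\to V$ iff there is a strictly defined $w\in\mathcal{Y}_2(\mathbb{R}^m,V)$ with $w=f$ a.e. on $B_1^m$ and $w=g$ $\mathcal{H}^{m-1}$-a.e. on $\partial B_1^m$; for $\mathbb{Q}$-valued functions apply this to $\xi\circ f$, $\xi\circ g$. Step minimizing sequence: let $\mathcal{M}$ be the set of strictly defined $u\in\mathcal{Y}_2(B_1^m,\mathbb{Q})$ with $u=f_0$ on $\partial B_1^m$ (same boundary values). Given $h>0$, set $f_h^0=f_0$ and for $k\ge1$ let $f_h^k\in\mathcal{M}$ minimize over $g\in\mathcal{M}$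 the functional $G(f_h^{k-1},g,h)=\mathrm{Dir}(g;B_1^m)+\frac{1}{h/2^k}\|\xi\circ f_h^{k-1}-\xi\circ g\|_{\mathcal{L}^2}^2$ (minimizers exist). Interpolation: for $i=1,2,3,\dots$, $F_h(t,x)=f_h^{i-1}(x)$ if $t\in[(i-1)h,\,ih-\frac{h}{2^i}]$, and $F_h(t,x)=\xi^{-1}\circ\rho\Big(\frac{ih-t}{h/2^i}\,\xi(f_h^{i-1}(x))+\frac{t-(ih-h/2^i)}{h/2^i}\,\xi(f_h^i(x))\Big)$ if $t\in[ih-\frac{h}{2^i},\,ih]$. *)

theory Defs
  imports "HOL-Analysis.Analysis" "HOL-Library.Multiset"
begin

section \<open>Sobolev functions\<close>

primrec C_k :: "nat \<Rightarrow> ('a::euclidean_space \<Rightarrow> real) \<Rightarrow> bool" where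
  "C_k 0 \<phi> \<longleftrightarrow> continuous_on UNIV \<phi>"
| "C_k (Suc k) \<phi> \<longleftrightarrow>
     (\<exists>D. (\<forall>x. (\<phi> has_derivative (\<lambda>h. \<Sum>b\<in>Basis. (h \<bullet> b) * D b x)) (at x)) \<and>
          (\<forall>b\<in>Basis. C_k k (D b)))"

definition test_functions :: "'a::euclidean_space set \<Rightarrow> ('a \<Rightarrow> real) set" where
  "test_functions U =
     {\<phi>. (\<forall>k. C_k k \<phi>) \<and> compact (closure {x. \<phi> x \<noteq> 0}) \<and> closure {x. \<phi> x \<noteq> 0} \<subseteq> U}"

definition locally_summable :: "'a::euclidean_space set \<Rightarrow> ('a \<Rightarrow> 'b::euclidean_space) \<Rightarrow> bool" where
  "locally_summable A f \<longleftrightarrow> (\<forall>K. compact K \<and> K \<subseteq> A \<longrightarrow> set_integrable lebesgue K f)"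

definition square_summable :: "'a::euclidean_space set \<Rightarrow> ('a \<Rightarrow> 'b::euclidean_space) \<Rightarrow> bool" where
  "square_summable A f \<longleftrightarrow>
     f \<in> borel_measurable (lebesgue_on A) \<and> integrable (lebesgue_on A) (\<lambda>x. (norm (f x))\<^sup>2)"

text \<open>\<open>D b\<close> is the distributional derivative of \<open>u\<close> in the direction of the basis vector \<open>b\<close>.
  Sets \<open>A\<close> such as closed balls are treated as their interior.\<close>

definition weak_gradient ::
    "'a::euclidean_space set \<Rightarrow> ('a \<Rightarrow> 'b::euclidean_space) \<Rightarrow> ('a \<Rightarrow> 'a \<Rightarrow> 'b) \<Rightarrow> bool" where
  "weak_gradient A u D \<longleftrightarrow>
     locally_summable (interior A) u \<and>
     (\<forall>b\<in>Basis. locally_summable (interior A) (D b) \<and>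
        (\<forall>\<phi>\<in>test_functions (interior A).
           (LINT x:interior A|lebesgue. frechet_derivative \<phi> (at x) b *\<^sub>R u x) =
           - (LINT x:interior A|lebesgue. \<phi> x *\<^sub>R D b x)))"

definition Y2 :: "'a::euclidean_space set \<Rightarrow> ('a \<Rightarrow> 'b::euclidean_space) set" where
  "Y2 A = {u. square_summable A u \<and>
              (\<exists>D. weak_gradient A u D \<and> (\<forall>b\<in>Basis. square_summable A (D b)))}"

definition l2_norm_sq :: "'a::euclidean_space set \<Rightarrow> ('a \<Rightarrow> 'b::euclidean_space) \<Rightarrow> ennreal" where
  "l2_norm_sq A u = (\<integral>\<^sup>+x. ennreal ((norm (u x))\<^sup>2) \<partial>lebesgue_on A)"

text \<open>The integral of the squared Hilbert-Schmidt norm of \<open>Du\<close>. The weak gradient is unique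
  almost everywhere; the energy of a function without one is infinite.\<close>

definition dirichlet_integral ::
    "'a::euclidean_space set \<Rightarrow> ('a \<Rightarrow> 'b::euclidean_space) \<Rightarrow> ennreal" where
  "dirichlet_integral A u =
     (if \<exists>D. weak_gradient A u D
      then (let D = (SOME D. weak_gradient A u D)
            in \<integral>\<^sup>+x. ennreal (\<Sum>b\<in>Basis. (norm (D b x))\<^sup>2) \<partial>lebesgue_on A)
      else \<infinity>)"

definition sobolev_norm :: "'a::euclidean_space set \<Rightarrow> ('a \<Rightarrow> 'b::euclidean_space) \<Rightarrow> real" where
  "sobolev_norm A u = sqrt (enn2real (l2_norm_sq A u + dirichlet_integral A u))"

text \<open>Elements of \<open>Y2 A\<close> are functions rather than equivalence classes, so \<open>sobolev_norm\<close> is only a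
  seminorm; bounded functionals do not distinguish functions that agree almost everywhere.\<close>

definition bounded_functional ::
    "'a::euclidean_space set \<Rightarrow> (('a \<Rightarrow> 'b::euclidean_space) \<Rightarrow> real) \<Rightarrow> bool" where
  "bounded_functional A \<Lambda> \<longleftrightarrow>
     (\<forall>u\<in>Y2 A. \<forall>v\<in>Y2 A. \<Lambda> (\<lambda>x. u x + v x) = \<Lambda> u + \<Lambda> v) \<and>
     (\<forall>c. \<forall>u\<in>Y2 A. \<Lambda> (\<lambda>x. c *\<^sub>R u x) = c * \<Lambda> u) \<and>
     (\<exists>C. \<forall>u\<in>Y2 A. \<bar>\<Lambda> u\<bar> \<le> C * sobolev_norm A u)"

definition weakly_converges ::
    "'a::euclidean_space set \<Rightarrow> (nat \<Rightarrow> 'a \<Rightarrow> 'b::euclidean_space) \<Rightarrow> ('a \<Rightarrow> 'b) \<Rightarrow> bool" where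
  "weakly_converges A U u \<longleftrightarrow>
     (\<forall>k. U k \<in> Y2 A) \<and> u \<in> Y2 A \<and>
     (\<forall>\<Lambda>. bounded_functional A \<Lambda> \<longrightarrow> (\<lambda>k. \<Lambda> (U k)) \<longlonglongrightarrow> \<Lambda> u)"

text \<open>At boundary points of \<open>A\<close> the averages are taken over the part of the ball in \<open>A\<close>, where \<open>f\<close>
  is defined.\<close>

definition strictly_defined ::
    "'a::euclidean_space set \<Rightarrow> ('a \<Rightarrow> 'b::euclidean_space) \<Rightarrow> bool" where
  "strictly_defined A f \<longleftrightarrow>
     locally_summable A f \<and>
     (\<forall>x\<in>A. \<forall>y.
        ((\<lambda>r. (LINT z:cball x r \<inter> A|lebesgue. norm (f z - y)) / measure lebesgue (cball x r \<inter> A))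
           \<longlongrightarrow> 0) (at_right 0) \<longrightarrow> f x = y)"

text \<open>\<open>diameter\<close> is meaningful for bounded sets only, and the empty set has to contribute \<open>0\<close> also
  for \<open>s = 0\<close>.\<close>

definition hausdorff_measure :: "nat \<Rightarrow> 'a::euclidean_space set \<Rightarrow> ennreal" where
  "hausdorff_measure s E =
     (SUP \<delta>\<in>{0::real<..}.
        INF C\<in>{C::nat \<Rightarrow> 'a set. E \<subseteq> (\<Union>i. C i) \<and> (\<forall>i. bounded (C i) \<and> diameter (C i) \<le> \<delta>)}.
          \<Sum>i. if C i = {} then 0
               else ennreal (unit_ball_vol (real s) * (diameter (C i) / 2) ^ s))"

definition has_boundary_values ::
    "('a::euclidean_space \<Rightarrow> 'b::euclidean_space) \<Rightarrow> ('a \<Rightarrow> 'b) \<Rightarrow> bool" where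
  "has_boundary_values f g \<longleftrightarrow>
     (\<exists>w. w \<in> Y2 UNIV \<and> strictly_defined UNIV w \<and>
          (AE x in lebesgue_on (cball 0 1). w x = f x) \<and>
          hausdorff_measure (DIM('a) - 1) {x \<in> sphere 0 1. w x \<noteq> g x} = 0)"


section \<open>Unordered tuples and their embedding\<close>

definition tuples :: "nat \<Rightarrow> (real^'n) multiset set" where
  "tuples Q = {p. size p = Q}"

definition tuple_dist :: "(real^'n) multiset \<Rightarrow> (real^'n) multiset \<Rightarrow> real" where
  "tuple_dist p q =
     Min {sqrt (\<Sum>i<size p. (norm (xs ! i - ys ! \<sigma> i))\<^sup>2) | xs ys \<sigma>.
            mset xs = p \<and> mset ys = q \<and> \<sigma> permutes {..<size p}}"

definition tuple_norm :: "(real^'n) multiset \<Rightarrow> real" where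
  "tuple_norm p = sqrt (\<Sum>x\<in>#p. (norm x)\<^sup>2)"

text \<open>The index type \<open>'q\<close> has \<open>Q\<close> elements; its element \<open>j\<close> stands for the position
  \<open>card {i. i < j}\<close> in the nondecreasing rearrangement.\<close>

definition zeta :: "(real^'n \<Rightarrow> real) \<Rightarrow> (real^'n) multiset \<Rightarrow> real^'q::{finite,linorder}" where
  "zeta \<pi> p = (\<chi> j. sorted_list_of_multiset (image_mset \<pi> p) ! card {i. i < j})"

text \<open>There is one orthonormal system \<open>e s\<close> for each \<open>s :: 's\<close>, so the number of projections is
  \<open>P = CARD('s) * CARD('n)\<close>, and \<open>coords\<close> with its Euclidean norm is the space of real vectors of
  length \<open>P * Q\<close>.\<close>

type_synonym ('q, 'n, 's) coords = "(((real, 'q) vec, 'n) vec, 's) vec"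

definition white_embedding ::
    "((real^'n) multiset \<Rightarrow> ('q::{finite,linorder}, 'n, 's::finite) coords) \<Rightarrow> bool" where
  "white_embedding \<xi> \<longleftrightarrow>
     (\<exists>c>0. \<exists>e :: 's \<Rightarrow> 'n \<Rightarrow> real^'n.
        (\<forall>s i j. e s i \<bullet> e s j = (if i = j then 1 else 0)) \<and>
        (\<forall>p\<in>tuples CARD('q). \<xi> p = c *\<^sub>R (\<chi> s. \<chi> i. zeta (\<lambda>x. e s i \<bullet> x) p))) \<and>
     (\<exists>L>0. \<forall>p\<in>tuples CARD('q). \<forall>q\<in>tuples CARD('q).
        norm (\<xi> p - \<xi> q) \<le> L * tuple_dist p q \<and> tuple_dist p q \<le> L * norm (\<xi> p - \<xi> q)) \<and>
     closed (\<xi> ` tuples CARD('q)) \<and>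
     (\<forall>p\<in>tuples CARD('q). norm (\<xi> p) = tuple_norm p) \<and>
     (\<forall>p\<in>tuples CARD('q). \<exists>\<delta>>0. \<forall>q\<in>tuples CARD('q).
        tuple_dist p q < \<delta> \<longrightarrow> norm (\<xi> p - \<xi> q) = tuple_dist p q)"

definition lipschitz_retraction ::
    "((real^'n) multiset \<Rightarrow> ('q::{finite,linorder}, 'n, 's::finite) coords) \<Rightarrow>
     (('q, 'n, 's) coords \<Rightarrow> ('q, 'n, 's) coords) \<Rightarrow> bool" where
  "lipschitz_retraction \<xi> \<rho> \<longleftrightarrow>
     (\<exists>L. L-lipschitz_on UNIV \<rho>) \<and>
     range \<rho> \<subseteq> \<xi> ` tuples CARD('q) \<and>
     (\<forall>x\<in>\<xi> ` tuples CARD('q). \<rho> x = x)"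


section \<open>The step minimizing sequence and its interpolation\<close>

definition Y2_tuples ::
    "((real^'n) multiset \<Rightarrow> ('q::{finite,linorder}, 'n, 's::finite) coords) \<Rightarrow>
     'a::euclidean_space set \<Rightarrow> ('a \<Rightarrow> (real^'n) multiset) set" where
  "Y2_tuples \<xi> A = {u. (\<forall>x\<in>A. u x \<in> tuples CARD('q)) \<and> \<xi> \<circ> u \<in> Y2 A}"

text \<open>The Dirichlet energy is the integral of the squared norm of the derivative of \<open>\<xi> \<circ> u\<close>, which
  equals that of the sorted standard coordinates of \<open>u\<close> because \<open>\<xi>\<close> is locally isometric.\<close>

definition Dir ::
    "((real^'n) multiset \<Rightarrow> ('q::{finite,linorder}, 'n, 's::finite) coords) \<Rightarrow>
     ('a::euclidean_space \<Rightarrow> (real^'n) multiset) \<Rightarrow> 'a set \<Rightarrow> ennreal" where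
  "Dir \<xi> u A = dirichlet_integral A (\<xi> \<circ> u)"

text \<open>Having the same boundary values as \<open>f0\<close> means that some \<open>g\<close> on the sphere is a boundary value
  of both functions.\<close>

definition competitors ::
    "((real^'n) multiset \<Rightarrow> ('q::{finite,linorder}, 'n, 's::finite) coords) \<Rightarrow>
     (real^'m \<Rightarrow> (real^'n) multiset) \<Rightarrow> (real^'m \<Rightarrow> (real^'n) multiset) set" where
  "competitors \<xi> f0 =
     {u \<in> Y2_tuples \<xi> (cball 0 1).
        strictly_defined (cball 0 1) (\<xi> \<circ> u) \<and>
        (\<exists>g. (\<forall>x\<in>sphere 0 1. g x \<in> tuples CARD('q)) \<and>
             has_boundary_values (\<xi> \<circ> u) (\<xi> \<circ> g) \<and> has_boundary_values (\<xi> \<circ> f0) (\<xi> \<circ> g))}"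

definition step_functional ::
    "((real^'n) multiset \<Rightarrow> ('q::{finite,linorder}, 'n, 's::finite) coords) \<Rightarrow> real \<Rightarrow> nat \<Rightarrow>
     (real^'m \<Rightarrow> (real^'n) multiset) \<Rightarrow> (real^'m \<Rightarrow> (real^'n) multiset) \<Rightarrow> ennreal" where
  "step_functional \<xi> h k f g =
     Dir \<xi> g (cball 0 1) +
     ennreal (1 / (h / 2 ^ k)) * l2_norm_sq (cball 0 1) (\<lambda>x. \<xi> (f x) - \<xi> (g x))"

definition step_minimizing ::
    "((real^'n) multiset \<Rightarrow> ('q::{finite,linorder}, 'n, 's::finite) coords) \<Rightarrow>
     (real^'m \<Rightarrow> (real^'n) multiset) \<Rightarrow> real \<Rightarrow>
     (nat \<Rightarrow> real^'m \<Rightarrow> (real^'n) multiset) \<Rightarrow> bool" where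
  "step_minimizing \<xi> f0 h f \<longleftrightarrow>
     f 0 = f0 \<and>
     (\<forall>k\<ge>1. f k \<in> competitors \<xi> f0 \<and>
        (\<forall>g\<in>competitors \<xi> f0.
           step_functional \<xi> h k (f (k - 1)) (f k) \<le> step_functional \<xi> h k (f (k - 1)) g))"

text \<open>These conditions determine \<open>F\<close> on \<open>{0..} \<times> cball 0 1\<close>: at common endpoints of two intervals
  they agree because \<open>\<rho>\<close> fixes the image of \<open>\<xi>\<close>.\<close>

definition interpolation ::
    "((real^'n) multiset \<Rightarrow> ('q::{finite,linorder}, 'n, 's::finite) coords) \<Rightarrow>
     (('q, 'n, 's) coords \<Rightarrow> ('q, 'n, 's) coords) \<Rightarrow> real \<Rightarrow>
     (nat \<Rightarrow> real^'m \<Rightarrow> (real^'n) multiset) \<Rightarrow> (real \<times> (real^'m) \<Rightarrow> (real^'n) multiset) \<Rightarrow> bool" where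
  "interpolation \<xi> \<rho> h f F \<longleftrightarrow>
     (\<forall>i\<ge>1. \<forall>x\<in>cball 0 1.
        (\<forall>t\<in>{(real i - 1) * h .. real i * h - h / 2 ^ i}. F (t, x) = f (i - 1) x) \<and>
        (\<forall>t\<in>{real i * h - h / 2 ^ i .. real i * h}.
           F (t, x) = inv_into (tuples CARD('q)) \<xi> (\<rho>
             (((real i * h - t) / (h / 2 ^ i)) *\<^sub>R \<xi> (f (i - 1) x) +
              ((t - (real i * h - h / 2 ^ i)) / (h / 2 ^ i)) *\<^sub>R \<xi> (f i x)))))"

end

(* Away from the short transition intervals, whose total length for F_h is at most h, each slice of F_h
   is a minimizer f_h^i, and Dir(f_h^i) <= Dir(f_0) because f_h^(i-1) competes with f_h^i. By
   Borel-Cantelli almost every t lies in a transition interval for only finitely many k. The spatial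
   gradients of F_k, restricted to a set G of times that are good for all k >= N, are tested
   against the spatial gradient of F itself; this gives
   int_G Dir(F_t) dt <= (Dir(f_0) |G| + int_G Dir(F_t) dt) / 2, so Dir(F_t) > Dir(f_0) can hold on
   a null subset of G only. That almost every slice of a Sobolev function is a Sobolev function
   with the sliced gradient follows by testing with countably many functions. *)

theory Submission
  imports Defs "HOL-Computational_Algebra.Polynomial"
begin

section \<open>Smooth cutoff functions\<close>

text \<open>The obstacle is that the energy of a slice is defined through a gradient chosen for that
  slice alone, so nothing is known about its dependence on \<open>t\<close>. It is replaced by
  \<open>slice_energy\<close>, computed from one gradient on the space-time cylinder and measurable
  in \<open>t\<close> by Tonelli. For the two to agree at a time \<open>t\<close>, the slice has to
  satisfy uncountably many integral identities at once; each of them costs a null set of times,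
  which is why the tests are reduced to a countable family. A slice without a weak gradient has
  infinite energy by definition, so for finite energy of \<open>f0\<close> the inequality includes
  weak differentiability of almost every slice. Weak convergence controls integrals over time only.
  A bound at individual times comes back by integrating over just those times at which it fails. The
  one half in the estimate is that of a . b \<le> (|a|^2 + |b|^2) / 2, with a from F_k and b from F;
  the term with F can be absorbed because it is finite. Borel-Cantelli applies because h runs
  through a sequence dominated by powers of 1/2, so that the total lengths of the transition
  intervals are summable.\<close>

lemma C_k_SucE:
  assumes "C_k (Suc k) \<phi>"
  obtains D where "\<And>x. (\<phi> has_derivative (\<lambda>h. \<Sum>b\<in>Basis. (h \<bullet> b) * D b x)) (at x)"
    "\<And>b. b \<in> Basis \<Longrightarrow> C_k k (D b)"
  using assms unfolding C_k.simps(2) by blast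

lemma C_k_SucI:
  assumes "\<And>x. (\<phi> has_derivative (\<lambda>h. \<Sum>b\<in>Basis. (h \<bullet> b) * D b x)) (at x)"
    "\<And>b. b \<in> Basis \<Longrightarrow> C_k k (D b)"
  shows "C_k (Suc k) \<phi>"
  using assms unfolding C_k.simps(2) by blast

lemma C_k_imp_continuous_on: "C_k k \<phi> \<Longrightarrow> continuous_on S \<phi>"
proof (cases k)
  case 0
  then show "C_k k \<phi> \<Longrightarrow> continuous_on S \<phi>" by (auto intro: continuous_on_subset)
next
  case (Suc j)
  then show "C_k k \<phi> \<Longrightarrow> continuous_on S \<phi>"
    by (fastforce intro!: continuous_at_imp_continuous_on dest: has_derivative_continuous)
qed

lemma C_k_SucD: "C_k (Suc k) \<phi> \<Longrightarrow> C_k k \<phi>"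
proof (induction k arbitrary: \<phi>)
  case 0
  then show ?case by (simp only: C_k.simps(1)) (rule C_k_imp_continuous_on)
next
  case (Suc k)
  then show ?case unfolding C_k.simps(2)[of "Suc k"] C_k.simps(2)[of k] by blast
qed

lemma C_k_const: "C_k k (\<lambda>x::'a::euclidean_space. c)"
proof (induction k arbitrary: c)
  case (Suc k)
  then show ?case by (intro C_k_SucI[where D="\<lambda>b x. 0"]) simp_all
qed auto

lemma C_k_add: "C_k k \<phi> \<Longrightarrow> C_k k \<psi> \<Longrightarrow> C_k k (\<lambda>x. \<phi> x + \<psi> x)"
proof (induction k arbitrary: \<phi> \<psi>)
  case (Suc k)
  obtain D where
    D: "\<And>x. (\<phi> has_derivative (\<lambda>h. \<Sum>b\<in>Basis. (h \<bullet> b) * D b x)) (at x)" "\<And>b. b \<in> Basis \<Longrightarrow> C_k k (D b)"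
    using C_k_SucE[OF Suc.prems(1)] by metis
  obtain D' where
    D': "\<And>x. (\<psi> has_derivative (\<lambda>h. \<Sum>b\<in>Basis. (h \<bullet> b) * D' b x)) (at x)" "\<And>b. b \<in> Basis \<Longrightarrow> C_k k (D' b)"
    using C_k_SucE[OF Suc.prems(2)] by metis
  have "((\<lambda>x. \<phi> x + \<psi> x) has_derivative (\<lambda>h. \<Sum>b\<in>Basis. (h \<bullet> b) * (D b x + D' b x))) (at x)" for x
    using has_derivative_add[OF D(1)[of x] D'(1)[of x]]
    by (simp add: algebra_simps sum.distrib)
  then show ?case using Suc.IH D D' by (intro C_k_SucI[where D="\<lambda>b x. D b x + D' b x"]) simp_all
qed (simp add: continuous_on_add)

lemma C_k_mult: "C_k k \<phi> \<Longrightarrow> C_k k \<psi> \<Longrightarrow> C_k k (\<lambda>x. \<phi> x * \<psi> x)"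
proof (induction k arbitrary: \<phi> \<psi>)
  case (Suc k)
  obtain D where
    D: "\<And>x. (\<phi> has_derivative (\<lambda>h. \<Sum>b\<in>Basis. (h \<bullet> b) * D b x)) (at x)" "\<And>b. b \<in> Basis \<Longrightarrow> C_k k (D b)"
    using C_k_SucE[OF Suc.prems(1)] by metis
  obtain D' where
    D': "\<And>x. (\<psi> has_derivative (\<lambda>h. \<Sum>b\<in>Basis. (h \<bullet> b) * D' b x)) (at x)" "\<And>b. b \<in> Basis \<Longrightarrow> C_k k (D' b)"
    using C_k_SucE[OF Suc.prems(2)] by metis
  have "((\<lambda>x. \<phi> x * \<psi> x) has_derivative
      (\<lambda>h. \<Sum>b\<in>Basis. (h \<bullet> b) * (\<phi> x * D' b x + D b x * \<psi> x))) (at x)" for x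
  proof (rule has_derivative_eq_rhs[OF has_derivative_mult[OF D(1)[of x] D'(1)[of x]]], rule ext)
    fix h
    show "\<phi> x * (\<Sum>b\<in>Basis. (h \<bullet> b) * D' b x) + (\<Sum>b\<in>Basis. (h \<bullet> b) * D b x) * \<psi> x
        = (\<Sum>b\<in>Basis. (h \<bullet> b) * (\<phi> x * D' b x + D b x * \<psi> x))"
      unfolding sum_distrib_left sum_distrib_right sum.distrib[symmetric]
      by (intro sum.cong refl) (simp add: algebra_simps)
  qed
  \<comment> \<open>The product rule keeps the undifferentiated factors, so these are first lowered
    from order \<open>Suc k\<close> to order \<open>k\<close>.\<close>
  moreover have "C_k k (\<lambda>x. \<phi> x * D' b x + D b x * \<psi> x)" if "b \<in> Basis" for b
    using that Suc.prems[THEN C_k_SucD] D D' by (intro C_k_add Suc.IH) simp_all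
  ultimately show ?case by (rule C_k_SucI)
qed (simp add: continuous_on_mult)

lemma C_k_sum: "(\<And>i. i \<in> I \<Longrightarrow> C_k k (\<phi> i)) \<Longrightarrow> C_k k (\<lambda>x. \<Sum>i\<in>I. \<phi> i x)"
  by (induction I rule: infinite_finite_induct) (auto intro: C_k_const C_k_add)

lemma C_k_prod: "(\<And>i. i \<in> I \<Longrightarrow> C_k k (\<phi> i)) \<Longrightarrow> C_k k (\<lambda>x. \<Prod>i\<in>I. \<phi> i x)"
proof (induction I rule: infinite_finite_induct)
  case (insert i I)
  then show ?case using C_k_mult[of k "\<phi> i" "\<lambda>x. \<Prod>i\<in>I. \<phi> i x"] by simp
qed (simp_all add: C_k_const)

text \<open>By the chain rule the partial derivatives are constant linear combinations of the
  \<open>D b\<close> composed with the same affine map, so the induction closes. The two spaces may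
  differ because the lemma serves scaled coordinate functionals as well as the projections of a
  product onto its factors.\<close>

lemma C_k_compose_affine:
  fixes L :: "'a::euclidean_space \<Rightarrow> 'b::euclidean_space"
  assumes "linear L"
  shows "C_k k \<phi> \<Longrightarrow> C_k k (\<lambda>x. \<phi> (L x + c))"
proof (induction k arbitrary: \<phi>)
  case 0
  have "continuous_on UNIV (\<lambda>x. L x + c)"
    by (intro continuous_intros linear_continuous_on assms linear_linear[THEN iffD2])
  then show ?case using 0 by (auto intro: continuous_on_compose2)
next
  case (Suc k)
  obtain D where
    D: "\<And>x. (\<phi> has_derivative (\<lambda>h. \<Sum>b\<in>Basis. (h \<bullet> b) * D b x)) (at x)" "\<And>b. b \<in> Basis \<Longrightarrow> C_k k (D b)"
    using C_k_SucE[OF Suc.prems] by metis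
  have L: "((\<lambda>x. L x + c) has_derivative L) (at x)" for x
    by (intro has_derivative_add_const linear_imp_has_derivative assms)
  have "((\<lambda>x. \<phi> (L x + c)) has_derivative
      (\<lambda>h. \<Sum>a\<in>Basis. (h \<bullet> a) * (\<Sum>b\<in>Basis. (L a \<bullet> b) * D b (L x + c)))) (at x)" for x
  proof -
    have "(\<Sum>b\<in>Basis. (L h \<bullet> b) * D b y) = (\<Sum>a\<in>Basis. (h \<bullet> a) * (\<Sum>b\<in>Basis. (L a \<bullet> b) * D b y))" for h y
    proof -
      have "L h = L (\<Sum>a\<in>Basis. (h \<bullet> a) *\<^sub>R a)" by (simp add: euclidean_representation)
      also have "\<dots> = (\<Sum>a\<in>Basis. (h \<bullet> a) *\<^sub>R L a)"
        by (simp add: linear_sum[OF assms] linear_cmul[OF assms])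
      finally have "(\<Sum>b\<in>Basis. (L h \<bullet> b) * D b y)
          = (\<Sum>b\<in>Basis. \<Sum>a\<in>Basis. (h \<bullet> a) * ((L a \<bullet> b) * D b y))"
        by (simp add: inner_sum_left sum_distrib_right mult.assoc)
      then show ?thesis by (subst (asm) sum.swap) (simp add: sum_distrib_left)
    qed
    then show ?thesis
      by (intro has_derivative_eq_rhs[OF has_derivative_compose[OF L D(1)]]) (rule ext)
  qed
  moreover have "C_k k (\<lambda>x. \<Sum>b\<in>Basis. (L a \<bullet> b) * D b (L x + c))" for a
    using D(2) by (intro C_k_sum C_k_mult C_k_const Suc.IH)
  ultimately show ?case by (rule C_k_SucI)
qed

text \<open>The functions of this form are closed under differentiation, hence all of them are smooth.\<close>

definition poly_exp_inverse :: "real poly \<Rightarrow> real \<Rightarrow> real" where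
  "poly_exp_inverse p y = (if y > 0 then poly p (inverse y) * exp (- inverse y) else 0)"

text \<open>With z = 1 / y this is the decay of p(z) exp(-z) at infinity, taken term by term in the
  coefficients of \<open>p\<close>.\<close>

lemma tendsto_poly_exp_inverse: "((\<lambda>y::real. poly p (inverse y) * exp (- inverse y)) \<longlongrightarrow> 0) (at_right 0)"
proof -
  have "((\<lambda>z. poly p z * exp (- z)) \<longlongrightarrow> 0) at_top"
  proof -
    have "((\<lambda>z::real. \<Sum>i\<le>degree p. coeff p i * (z ^ i / exp z)) \<longlongrightarrow> (\<Sum>i\<le>degree p. coeff p i * 0)) at_top"
      by (intro tendsto_sum tendsto_mult tendsto_const tendsto_power_div_exp_0)
    then show ?thesis
      by (simp add: poly_altdef exp_minus sum_distrib_right divide_inverse mult.assoc)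
  qed
  then show ?thesis
    by (rule filterlim_compose) (rule filterlim_inverse_at_top_right)
qed

text \<open>With z = 1 / y and dz/dy = -z^2, the derivative of p(z) exp(-z) is z^2 (p(z) - p'(z))
  exp(-z); this is the origin of \<open>monom 1 2 * (p - pderiv p)\<close>. At \<open>y = 0\<close>
  the two one-sided difference quotients are computed.\<close>

lemma poly_exp_inverse_has_derivative:
  "(poly_exp_inverse p has_real_derivative poly_exp_inverse (monom 1 2 * (p - pderiv p)) y) (at y)"
proof -
  consider "y > 0" | "y < 0" | "y = 0" by linarith
  then show ?thesis
  proof cases
    case 1
    have ev: "eventually (\<lambda>z. z > 0) (nhds y)" using 1 by (simp add: eventually_nhds_in_open[of "{0<..}", simplified])
    have "((\<lambda>y. poly p (inverse y) * exp (- inverse y)) has_real_derivative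
       poly_exp_inverse (monom 1 2 * (p - pderiv p)) y) (at y)"
      using 1 by (auto intro!: derivative_eq_intros DERIV_chain'[OF _ poly_DERIV]
          simp: poly_exp_inverse_def poly_monom field_simps power2_eq_square)
    then show ?thesis
      by (rule DERIV_cong_ev[THEN iffD1, rotated -1])
        (auto simp: poly_exp_inverse_def eventually_mono[OF ev])
  next
    case 2
    have ev: "eventually (\<lambda>z. z < 0) (nhds y)" using 2 by (simp add: eventually_nhds_in_open[of "{..<0}", simplified])
    have "((\<lambda>y. 0) has_real_derivative poly_exp_inverse (monom 1 2 * (p - pderiv p)) y) (at y)"
      using 2 by (simp add: poly_exp_inverse_def)
    then show ?thesis
      by (rule DERIV_cong_ev[THEN iffD1, rotated -1])
        (auto simp: poly_exp_inverse_def eventually_mono[OF ev])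
  next
    case 3
    \<comment> \<open>Division by \<open>h\<close> multiplies p(1/h) by 1/h, which replaces
      \<open>p\<close> by \<open>pCons 0 p\<close>.\<close>
    have "((\<lambda>h. poly_exp_inverse p h / h) \<longlongrightarrow> 0) (at_right 0)"
      by (rule Lim_transform_eventually[OF tendsto_poly_exp_inverse[of "pCons 0 p"]])
        (auto simp: poly_exp_inverse_def field_simps eventually_at_right_less intro!: eventually_at_rightI[of _ 1])
    moreover have "((\<lambda>h. poly_exp_inverse p h / h) \<longlongrightarrow> 0) (at_left 0)"
      by (rule Lim_transform_eventually[OF tendsto_const])
        (auto simp: poly_exp_inverse_def intro!: eventually_at_leftI[of "-1"])
    ultimately have "((\<lambda>h. poly_exp_inverse p h / h) \<longlongrightarrow> 0) (at 0)"
      by (simp add: filterlim_split_at)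
    then show ?thesis using 3 by (simp add: DERIV_def poly_exp_inverse_def)
  qed
qed

lemma C_k_poly_exp_inverse: "C_k k (poly_exp_inverse p)"
proof (induction k arbitrary: p)
  case 0
  show ?case
    using poly_exp_inverse_has_derivative
    by (auto intro!: continuous_at_imp_continuous_on DERIV_isCont)
next
  case (Suc k)
  have "(poly_exp_inverse p has_derivative (\<lambda>h. h * poly_exp_inverse (monom 1 2 * (p - pderiv p)) y)) (at y)" for y
    using poly_exp_inverse_has_derivative[of p y]
    by (simp add: has_field_derivative_def mult.commute[of _ "poly_exp_inverse _ _"] mult_commute_abs)
  then show ?case
    using Suc by (intro C_k_SucI[where D="\<lambda>_. poly_exp_inverse (monom 1 2 * (p - pderiv p))"]) simp_all
qed

text \<open>Each factor is exp(-1/d), extended by 0 to d \<le> 0, where d is \<open>c\<close> times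
  the signed distance to a face. For every positive \<open>c\<close> the function is positive
  exactly on the open box, and growing \<open>c\<close> drives its values there to 1. Indicators of
  boxes thus become limits of test functions supported in one compact set.\<close>

definition box_bump :: "'a::euclidean_space \<Rightarrow> 'a \<Rightarrow> real \<Rightarrow> 'a \<Rightarrow> real" where
  "box_bump l u c x = (\<Prod>b\<in>Basis. poly_exp_inverse 1 (c * (x \<bullet> b - l \<bullet> b)) * poly_exp_inverse 1 (c * (u \<bullet> b - x \<bullet> b)))"

lemma C_k_box_bump: "C_k k (box_bump l u c)"
proof -
  have "C_k k (\<lambda>x. poly_exp_inverse 1 (c * (x \<bullet> b - l \<bullet> b)) * poly_exp_inverse 1 (c * (u \<bullet> b - x \<bullet> b)))" for b
  proof (rule C_k_mult)
    have "linear (\<lambda>x. c * (x \<bullet> b))" "linear (\<lambda>x. (-c) * (x \<bullet> b))"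
      by (auto intro!: linearI simp: algebra_simps)
    from C_k_compose_affine[OF this(1) C_k_poly_exp_inverse, of k 1 "- c * (l \<bullet> b)"]
      C_k_compose_affine[OF this(2) C_k_poly_exp_inverse, of k 1 "c * (u \<bullet> b)"]
    show "C_k k (\<lambda>x. poly_exp_inverse 1 (c * (x \<bullet> b - l \<bullet> b)))"
      "C_k k (\<lambda>x. poly_exp_inverse 1 (c * (u \<bullet> b - x \<bullet> b)))"
      by (simp_all add: algebra_simps)
  qed
  then show ?thesis unfolding box_bump_def by (intro C_k_prod)
qed

lemma box_bump_bounds: "0 \<le> box_bump l u c x" "box_bump l u c x \<le> 1"
proof -
  have *: "0 \<le> poly_exp_inverse 1 y" "poly_exp_inverse 1 y \<le> 1" for y
    by (auto simp: poly_exp_inverse_def)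
  show "0 \<le> box_bump l u c x" "box_bump l u c x \<le> 1"
    unfolding box_bump_def by (auto intro!: prod_nonneg prod_le_1 mult_le_one mult_nonneg_nonneg *)
qed

lemma box_bump_nonzero_iff: "c > 0 \<Longrightarrow> box_bump l u c x \<noteq> 0 \<longleftrightarrow> x \<in> box l u"
  by (auto simp: box_bump_def mem_box poly_exp_inverse_def zero_less_mult_iff split: if_splits)

lemma box_bump_tendsto_indicator: "(\<lambda>n. box_bump l u (real n) x) \<longlonglongrightarrow> indicator (box l u) x"
proof (cases "x \<in> box l u")
  case True
  have *: "(\<lambda>n. poly_exp_inverse 1 (real n * d)) \<longlonglongrightarrow> 1" if "d > 0" for d
  proof -
    have "(\<lambda>n. exp (- inverse (real n * d))) \<longlonglongrightarrow> 1" 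
    proof -
      have "(\<lambda>n. inverse (real n) * inverse d) \<longlonglongrightarrow> 0"
        using tendsto_mult[OF lim_inverse_n tendsto_const[of "inverse d"]] by simp
      from tendsto_exp[OF tendsto_minus[OF this]] show ?thesis by simp
    qed
    then show ?thesis
      by (rule Lim_transform_eventually)
        (use that in \<open>auto simp: poly_exp_inverse_def intro!: eventually_mono[OF eventually_gt_at_top[of 0]]\<close>)
  qed
  have "(\<lambda>n. box_bump l u (real n) x) \<longlonglongrightarrow> (\<Prod>b\<in>(Basis::'a set). 1 * 1)"
    unfolding box_bump_def using True by (intro tendsto_prod tendsto_mult *) (auto simp: mem_box)
  then show ?thesis using True by simp
next
  case False
  then have "eventually (\<lambda>n. box_bump l u (real n) x = 0) sequentially"
    using box_bump_nonzero_iff[of _ l u x] by (auto intro!: eventually_mono[OF eventually_gt_at_top[of 0]])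
  then show ?thesis using False tendsto_eventually by simp
qed

lemma box_bump_in_test_functions:
  assumes "cbox l u \<subseteq> U" "c > 0"
  shows "box_bump l u c \<in> test_functions U"
proof -
  have "closure {x. box_bump l u c x \<noteq> 0} \<subseteq> cbox l u"
    using assms(2) box_subset_cbox by (intro closure_minimal) (auto simp: box_bump_nonzero_iff)
  then show ?thesis
    unfolding test_functions_def using assms(1) compact_cbox
    by (auto simp: C_k_box_bump compact_eq_bounded_closed intro: bounded_subset[OF bounded_cbox])
qed

section \<open>The fundamental lemma of the calculus of variations\<close>

text \<open>\<open>g\<close> is summable on compact sets only, so the integrand on \<open>U\<close>
  is identified with one on \<open>K\<close>, where \<psi> is bounded.\<close>

lemma integrable_continuous_scaleR:
  fixes \<psi> :: "'a::euclidean_space \<Rightarrow> real" and g :: "'a \<Rightarrow> 'b::euclidean_space"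
  assumes "continuous_on UNIV \<psi>" "compact K" "K \<subseteq> U" "\<And>x. x \<notin> K \<Longrightarrow> \<psi> x = 0" "locally_summable U g"
  shows "set_integrable lebesgue U (\<lambda>x. \<psi> x *\<^sub>R g x)"
proof -
  have gK: "integrable lebesgue (\<lambda>x. indicat_real K x *\<^sub>R g x)"
    using assms(2,3,5) by (simp add: locally_summable_def set_integrable_def)
  obtain M where M: "\<And>x. x \<in> K \<Longrightarrow> \<bar>\<psi> x\<bar> \<le> M"
    using compact_imp_bounded[OF compact_continuous_image[OF continuous_on_subset[OF assms(1) subset_UNIV] assms(2)]]
    by (auto simp: bounded_iff)
  have \<psi>: "\<psi> \<in> borel_measurable lebesgue"
    using assms(1) by (intro measurable_completion) (auto intro: borel_measurable_continuous_onI)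
  have "integrable lebesgue (\<lambda>x. \<psi> x *\<^sub>R (indicat_real K x *\<^sub>R g x))"
  proof (rule Bochner_Integration.integrable_bound)
    show "integrable lebesgue (\<lambda>x. M *\<^sub>R (indicat_real K x *\<^sub>R g x))"
      using integrable_scaleR_right[of M, OF gK] .
    show "(\<lambda>x. \<psi> x *\<^sub>R (indicat_real K x *\<^sub>R g x)) \<in> borel_measurable lebesgue"
      using \<psi> borel_measurable_integrable[OF gK] by (rule borel_measurable_scaleR)
    show "AE x in lebesgue. norm (\<psi> x *\<^sub>R (indicat_real K x *\<^sub>R g x)) \<le> norm (M *\<^sub>R (indicat_real K x *\<^sub>R g x))"
    proof (rule AE_I2)
      fix x show "norm (\<psi> x *\<^sub>R (indicat_real K x *\<^sub>R g x)) \<le> norm (M *\<^sub>R (indicat_real K x *\<^sub>R g x))"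
        using M[of x] by (cases "x \<in> K") (auto intro!: mult_right_mono)
    qed
  qed
  moreover have "\<psi> x *\<^sub>R (indicat_real K x *\<^sub>R g x) = indicat_real U x *\<^sub>R (\<psi> x *\<^sub>R g x)" for x
    using assms(3,4) by (cases "x \<in> K") auto
  ultimately show ?thesis by (simp only: set_integrable_def)
qed

lemma locally_summable_integrable_box:
  assumes "locally_summable U g" "cbox l u \<subseteq> U"
  shows "integrable lebesgue (\<lambda>x. indicat_real (box l u) x *\<^sub>R g x)"
proof -
  have "set_integrable lebesgue (cbox l u) g"
    using assms by (auto simp: locally_summable_def)
  then have "set_integrable lebesgue (box l u) g"
    by (rule set_integrable_subset) (auto intro: sets_completionI_sets box_subset_cbox[THEN subsetD])
  then show ?thesis by (simp add: set_integrable_def)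
qed

text \<open>A Lebesgue measurable real function agrees almost everywhere with a Borel one; this is
  applied to each coordinate, and the finitely many exceptional sets are united. Borel versions give
  access to theorems about \<open>lborel\<close> and its products, which are not complete
  measures.\<close>

lemma borel_version:
  fixes f :: "'a::euclidean_space \<Rightarrow> 'b::euclidean_space"
  assumes "f \<in> borel_measurable lebesgue"
  obtains f' where "f' \<in> borel_measurable borel" "AE x in lborel. f x = f' x"
proof -
  have "\<exists>f'\<in>borel_measurable lborel. AE x in lborel. f x \<bullet> b = f' x" for b
    using assms by (intro completion_ex_borel_measurable_real borel_measurable_inner borel_measurable_const)
  then have "\<forall>b. \<exists>f'. f' \<in> borel_measurable borel \<and> (AE x in lborel. f x \<bullet> b = f' x)"
    by (simp add: Bex_def)
  from choice[OF this]
  obtain F where F: "\<And>b. F b \<in> borel_measurable borel" "\<And>b. AE x in lborel. f x \<bullet> b = F b x"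
    by blast
  show thesis
  proof (rule that)
    show "(\<lambda>x. \<Sum>b\<in>Basis. F b x *\<^sub>R b) \<in> borel_measurable borel" using F(1) by measurable
    have "AE x in lborel. \<forall>b\<in>Basis. f x \<bullet> b = F b x"
      using F(2) by (intro AE_finite_allI) auto
    then show "AE x in lborel. f x = (\<Sum>b\<in>Basis. F b x *\<^sub>R b)"
    proof eventually_elim
      case (elim x)
      then have "(\<Sum>b\<in>Basis. F b x *\<^sub>R b) = (\<Sum>b\<in>Basis. (f x \<bullet> b) *\<^sub>R b)" by simp
      then show ?case by (simp add: euclidean_representation)
    qed
  qed
qed

text \<open>Dynkin's argument: boxes are closed under intersection and generate the Borel sets, and
  the sets with vanishing integral are closed under complements and countable disjoint unions. The
  whole space is not a box, so complements rely on \<open>total\<close>.\<close>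

lemma AE_eq_0_if_integral_box_eq_0:
  fixes h :: "'a::euclidean_space \<Rightarrow> 'b::euclidean_space"
  assumes h: "integrable lborel h"
    and total: "integral\<^sup>L lborel h = 0"
    and box: "\<And>a b. (LINT x:box a b|lborel. h x) = 0"
  shows "AE x in lborel. h x = 0"
proof -
  let ?G = "range (\<lambda>(a, b). box a b :: 'a set)"
  have sets: "sets (lborel :: 'a measure) = sigma_sets UNIV ?G"
    unfolding sets_lborel by (subst borel_eq_box) simp
  have meas: "A \<in> sets lborel" if "A \<in> sigma_sets UNIV ?G" for A using that sets by simp
  have int: "integrable lborel (\<lambda>x. indicat_real A x *\<^sub>R h x)" if "A \<in> sigma_sets UNIV ?G" for A
    using h meas[OF that] by (rule integrable_mult_indicator[rotated])
  have "Int_stable ?G" by (auto simp: Int_stable_def box_Int_box)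
  moreover have "?G \<subseteq> Pow UNIV" by simp
  ultimately have "(LINT x:A|lborel. h x) = 0" if "A \<in> sigma_sets UNIV ?G" for A
    using that
  proof (induction A rule: sigma_sets_induct_disjoint)
    case (basic A)
    then show ?case using box by auto
  next
    case empty
    then show ?case by (simp add: set_lebesgue_integral_def)
  next
    case (compl A)
    have "(LINT x:UNIV - A|lborel. h x) = integral\<^sup>L lborel h - (LINT x:A|lborel. h x)"
      unfolding set_lebesgue_integral_def
      by (subst Bochner_Integration.integral_diff[symmetric, OF h int[OF compl(1)]])
        (auto intro!: Bochner_Integration.integral_cong simp: indicator_def)
    then show ?case using total compl by simp
  next
    case (union A)
    have "(LINT x:(\<Union>i. A i)|lborel. h x) = (\<Sum>i. LINT x:A i|lborel. h x)"
    proof (rule lebesgue_integral_countable_add)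
      have A: "A i \<in> sigma_sets UNIV ?G" for i using union(2) by blast
      then show "A i \<in> sets lborel" for i by (rule meas)
      show "set_integrable lborel (\<Union>i. A i) h"
        unfolding set_integrable_def using A by (intro int sigma_sets.Union)
    qed (use union(1) in \<open>auto simp: disjoint_family_on_def\<close>)
    then show ?case using union by simp
  qed
  then have "(LINT x:A|lborel. h x) = 0" if "A \<in> sets lborel" for A
    using that sets by simp
  then show ?thesis
    by (rule sigma_finite_measure.density_zero[OF sigma_finite_lborel h])
qed

text \<open>Bumps converge boundedly to indicators of boxes, so \<open>g\<close> has integral 0 over
  every open box whose closed box lies in \<open>U\<close>. Inside one such box this makes all Borel
  integrals vanish, and countably many such boxes cover \<open>U\<close>.\<close>

lemma fundamental_lemma:
  fixes g :: "'a::euclidean_space \<Rightarrow> 'b::euclidean_space"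
  assumes "open U" and g: "locally_summable U g"
    and test: "\<And>\<phi>. \<phi> \<in> test_functions U \<Longrightarrow> (LINT x:U|lebesgue. \<phi> x *\<^sub>R g x) = 0"
  shows "AE x in lebesgue. x \<in> U \<longrightarrow> g x = 0"
proof -
  have box0: "(LINT x|lebesgue. indicat_real (box l u) x *\<^sub>R g x) = 0" if lu: "cbox l u \<subseteq> U" for l u
  proof -
    have int: "integrable lebesgue (\<lambda>x. indicat_real (box l u) x *\<^sub>R g x)"
      using g lu by (rule locally_summable_integrable_box)
    have eq: "indicat_real U x *\<^sub>R (box_bump l u (real (Suc n)) x *\<^sub>R g x)
        = box_bump l u (real (Suc n)) x *\<^sub>R (indicat_real (box l u) x *\<^sub>R g x)" for n x
      using lu box_bump_nonzero_iff[of "real (Suc n)" l u x] box_subset_cbox[of l u]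
      by (cases "x \<in> box l u") auto
    \<comment> \<open>The bump already vanishes off the box; the extra indicator turns
      \<open>g\<close> into an integrable function, which then dominates the sequence.\<close>
    have "(\<lambda>n. LINT x|lebesgue. box_bump l u (real (Suc n)) x *\<^sub>R (indicat_real (box l u) x *\<^sub>R g x))
        \<longlonglongrightarrow> (LINT x|lebesgue. indicat_real (box l u) x *\<^sub>R (indicat_real (box l u) x *\<^sub>R g x))"
    proof (rule integral_dominated_convergence[where w = "\<lambda>x. norm (indicat_real (box l u) x *\<^sub>R g x)"])
      show "AE x in lebesgue. (\<lambda>n. box_bump l u (real (Suc n)) x *\<^sub>R (indicat_real (box l u) x *\<^sub>R g x))
          \<longlonglongrightarrow> indicat_real (box l u) x *\<^sub>R (indicat_real (box l u) x *\<^sub>R g x)"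
        using LIMSEQ_Suc[OF box_bump_tendsto_indicator] by (intro AE_I2 tendsto_scaleR tendsto_const)
      show "AE x in lebesgue. norm (box_bump l u (real (Suc n)) x *\<^sub>R (indicat_real (box l u) x *\<^sub>R g x))
          \<le> norm (indicat_real (box l u) x *\<^sub>R g x)" for n
        using box_bump_bounds[of l u "real (Suc n)"]
        by (intro AE_I2) (auto intro!: mult_left_le_one_le simp: abs_of_nonneg mult.assoc simp del: of_nat_Suc)
      show "(\<lambda>x. box_bump l u (real (Suc n)) x *\<^sub>R (indicat_real (box l u) x *\<^sub>R g x)) \<in> borel_measurable lebesgue" for n
      proof (rule borel_measurable_scaleR[OF _ borel_measurable_integrable[OF int]])
        show "box_bump l u (real (Suc n)) \<in> borel_measurable lebesgue"
          by (intro measurable_completion)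
            (simp add: borel_measurable_continuous_onI[OF C_k_imp_continuous_on[OF C_k_box_bump]])
      qed
      show "(\<lambda>x. indicat_real (box l u) x *\<^sub>R (indicat_real (box l u) x *\<^sub>R g x)) \<in> borel_measurable lebesgue"
        by (intro borel_measurable_scaleR[OF _ borel_measurable_integrable[OF int]])
          (auto intro: measurable_completion)
      show "integrable lebesgue (\<lambda>x. norm (indicat_real (box l u) x *\<^sub>R g x))"
        using int by (rule integrable_norm)
    qed
    moreover have "(LINT x|lebesgue. box_bump l u (real (Suc n)) x *\<^sub>R (indicat_real (box l u) x *\<^sub>R g x)) = 0" for n
      using test[OF box_bump_in_test_functions[OF lu, of "real (Suc n)"]]
      by (simp only: set_lebesgue_integral_def eq of_nat_0_less_iff zero_less_Suc)
    ultimately have "(LINT x|lebesgue. indicat_real (box l u) x *\<^sub>R (indicat_real (box l u) x *\<^sub>R g x)) = 0"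
      by (simp add: LIMSEQ_const_iff del: of_nat_Suc)
    moreover have "indicat_real (box l u) x *\<^sub>R (indicat_real (box l u) x *\<^sub>R g x) = indicat_real (box l u) x *\<^sub>R g x" for x
      by (cases "x \<in> box l u") auto
    ultimately show ?thesis by (simp only:)
  qed
  have local: "AE x in lebesgue. x \<in> box c d \<longrightarrow> g x = 0" if cd: "cbox c d \<subseteq> U" for c d
  proof -
    have int: "integrable lebesgue (\<lambda>x. indicat_real (box c d) x *\<^sub>R g x)"
      using g cd by (rule locally_summable_integrable_box)
    obtain h where h: "h \<in> borel_measurable borel" "AE x in lborel. indicat_real (box c d) x *\<^sub>R g x = h x"
      using borel_version[OF borel_measurable_integrable[OF int]] .
    have h': "AE x in lebesgue. indicat_real (box c d) x *\<^sub>R g x = h x" using h(2) by (rule AE_completion)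
    have "integrable lebesgue h"
      using int h' h(1) by (subst integrable_cong_AE[where g = "\<lambda>x. indicat_real (box c d) x *\<^sub>R g x"])
        (auto intro: measurable_completion)
    then have inth: "integrable lborel h" using h(1) by (simp add: integrable_completion)
    have restr: "(LINT x:A|lborel. h x) = (LINT x|lebesgue. indicat_real (A \<inter> box c d) x *\<^sub>R g x)"
      if "A \<in> sets borel" for A
    proof -
      have "(LINT x:A|lborel. h x) = (LINT x|lebesgue. indicat_real A x *\<^sub>R h x)"
        unfolding set_lebesgue_integral_def using h(1) that by (subst integral_completion) auto
      also have "\<dots> = (LINT x|lebesgue. indicat_real A x *\<^sub>R (indicat_real (box c d) x *\<^sub>R g x))"
      proof (rule integral_cong_AE)
        show "(\<lambda>x. indicat_real A x *\<^sub>R h x) \<in> borel_measurable lebesgue"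
          using h(1) that by (intro measurable_completion) auto
        show "(\<lambda>x. indicat_real A x *\<^sub>R (indicat_real (box c d) x *\<^sub>R g x)) \<in> borel_measurable lebesgue"
          by (intro borel_measurable_scaleR[OF _ borel_measurable_integrable[OF int]]
              borel_measurable_indicator sets_completionI_sets) (simp add: that)
        show "AE x in lebesgue. indicat_real A x *\<^sub>R h x = indicat_real A x *\<^sub>R (indicat_real (box c d) x *\<^sub>R g x)"
          using h' by eventually_elim simp
      qed
      finally show ?thesis by (simp add: indicator_inter_arith)
    qed
    have sub: "cbox l u \<subseteq> U" if "cbox l u \<subseteq> cbox c d" for l u using that cd by auto
    have "AE x in lborel. h x = 0"
    proof (rule AE_eq_0_if_integral_box_eq_0[OF inth])
      show "integral\<^sup>L lborel h = 0"
        using restr[of UNIV] box0[OF cd] by (simp add: set_lebesgue_integral_def)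
      fix a b
      obtain l u where lu: "box a b \<inter> box c d = box l u" using box_Int_box[of a b c d] by blast
      show "(LINT x:box a b|lborel. h x) = 0"
      \<comment> \<open>Only a nonempty open box has \<open>cbox l u\<close> as its closure, and
        only then does \<open>box l u \<subseteq> box c d\<close> yield the inclusion of closed
        boxes required for \<open>box0\<close>.\<close>
      proof (cases "box l u = {}")
        case True
        then show ?thesis using restr[of "box a b"] lu by simp
      next
        case False
        moreover have "box l u \<subseteq> box c d" using lu by blast
        moreover from calculation have "box c d \<noteq> {}" by blast
        ultimately have "cbox l u \<subseteq> cbox c d"
          using closure_mono[of "box l u" "box c d"] by (simp add: closure_box)
        then show ?thesis using restr[of "box a b"] lu box0[OF sub] by simp
      qed
    qed
    then have "AE x in lebesgue. h x = 0" by (rule AE_completion)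
    then show ?thesis using h' by eventually_elim (auto simp: indicator_def split: if_splits)
  qed
  let ?F = "{box a b |a b. cbox a b \<subseteq> U}"
  have "\<Union>?F = U"
  proof
    show "\<Union>?F \<subseteq> U" using box_subset_cbox by blast
    show "U \<subseteq> \<Union>?F"
    proof
      fix x assume "x \<in> U"
      then obtain a b where "x \<in> box a b" "cbox a b \<subseteq> U" using open_contains_cbox[OF assms(1)] by metis
      then show "x \<in> \<Union>?F" by blast
    qed
  qed
  \<comment> \<open>Exceptional sets can be united over countably many boxes only, hence a Lindelof
    subcover.\<close>
  moreover obtain F' where F': "F' \<subseteq> ?F" "countable F'" "\<Union>F' = \<Union>?F"
    by (rule Lindelof[of ?F]) (use open_box in auto)
  moreover have "AE x in lebesgue. \<forall>X\<in>F'. x \<in> X \<longrightarrow> g x = 0"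
    using F'(1,2) local by (subst AE_ball_countable) auto
  ultimately show ?thesis by (auto elim!: eventually_mono)
qed

section \<open>Uniqueness of weak gradients\<close>

lemma test_functionsD:
  assumes "\<phi> \<in> test_functions U"
  shows "C_k k \<phi>" "compact (closure {x. \<phi> x \<noteq> 0})" "closure {x. \<phi> x \<noteq> 0} \<subseteq> U"
    "x \<notin> closure {x. \<phi> x \<noteq> 0} \<Longrightarrow> \<phi> x = 0" "continuous_on S \<phi>"
proof -
  show *: "C_k k \<phi>" for k using assms by (simp add: test_functions_def)
  show "continuous_on S \<phi>" using C_k_imp_continuous_on[OF *] .
  show "x \<notin> closure {x. \<phi> x \<noteq> 0} \<Longrightarrow> \<phi> x = 0"
    using closure_subset[of "{x. \<phi> x \<noteq> 0}"] by auto
qed (use assms in \<open>auto simp: test_functions_def\<close>)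

lemma integrable_test_function_scaleR:
  assumes "\<phi> \<in> test_functions U" "locally_summable U g"
  shows "set_integrable lebesgue U (\<lambda>x. \<phi> x *\<^sub>R g x)"
  by (rule integrable_continuous_scaleR[OF _ _ _ _ assms(2)]) (rule test_functionsD[OF assms(1)] | assumption)+

lemma locally_summable_diff:
  "locally_summable A f \<Longrightarrow> locally_summable A g \<Longrightarrow> locally_summable A (\<lambda>x. f x - g x)"
  by (simp add: locally_summable_def)

lemma locally_summable_add:
  "locally_summable A f \<Longrightarrow> locally_summable A g \<Longrightarrow> locally_summable A (\<lambda>x. f x + g x)"
  by (simp add: locally_summable_def)

lemma locally_summable_scaleR:
  "locally_summable A f \<Longrightarrow> locally_summable A (\<lambda>x. c *\<^sub>R f x)"
  by (auto simp: locally_summable_def)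

lemma AE_eq_if_test_eq:
  assumes "open U" "locally_summable U f" "locally_summable U g"
    and "\<And>\<phi>. \<phi> \<in> test_functions U \<Longrightarrow> (LINT x:U|lebesgue. \<phi> x *\<^sub>R f x) = (LINT x:U|lebesgue. \<phi> x *\<^sub>R g x)"
  shows "AE x in lebesgue. x \<in> U \<longrightarrow> f x = g x"
proof -
  have "AE x in lebesgue. x \<in> U \<longrightarrow> f x - g x = 0"
  proof (rule fundamental_lemma[OF assms(1) locally_summable_diff[OF assms(2,3)]])
    fix \<phi> :: "'a \<Rightarrow> real" assume \<phi>: "\<phi> \<in> test_functions U"
    then show "(LINT x:U|lebesgue. \<phi> x *\<^sub>R (f x - g x)) = 0"
      using set_integral_diff(2)[OF integrable_test_function_scaleR[OF \<phi> assms(2)] integrable_test_function_scaleR[OF \<phi> assms(3)]]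
        assms(4)[OF \<phi>]
      by (simp add: scaleR_diff_right)
  qed
  then show ?thesis by simp
qed

lemma weak_gradient_unique:
  assumes "weak_gradient A u D" "weak_gradient A u D'" "b \<in> Basis"
  shows "AE x in lebesgue. x \<in> interior A \<longrightarrow> D b x = D' b x"
proof (rule AE_eq_if_test_eq)
  fix \<phi> :: "'a \<Rightarrow> real" assume "\<phi> \<in> test_functions (interior A)"
  then have "- (LINT x:interior A|lebesgue. \<phi> x *\<^sub>R D b x) = - (LINT x:interior A|lebesgue. \<phi> x *\<^sub>R D' b x)"
    using assms unfolding weak_gradient_def by metis
  then show "(LINT x:interior A|lebesgue. \<phi> x *\<^sub>R D b x) = (LINT x:interior A|lebesgue. \<phi> x *\<^sub>R D' b x)" by simp
qed (use assms in \<open>auto simp: weak_gradient_def\<close>)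

text \<open>The definition picks some gradient and integrates it over \<open>A\<close>, whereas weak
  gradients are determined only almost everywhere on \<open>interior A\<close>. Uniqueness there and
  the negligible remainder \<open>A - interior A\<close> make the value independent of the
  choice.\<close>

lemma dirichlet_integral_eq:
  assumes D: "weak_gradient A u D" and A: "A \<in> sets lebesgue" "negligible (A - interior A)"
  shows "dirichlet_integral A u
    = (\<integral>\<^sup>+x. ennreal (\<Sum>b\<in>Basis. (norm (D b x))\<^sup>2) * indicator (interior A) x \<partial>lebesgue)"
proof -
  define D' where "D' = (SOME D. weak_gradient A u D)"
  have D': "weak_gradient A u D'" unfolding D'_def using D by (rule someI[where P = "weak_gradient A u"])
  have "AE x in lebesgue. x \<notin> A - interior A"
    using A(2) by (intro AE_not_in) (simp add: negligible_iff_null_sets)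
  moreover have "AE x in lebesgue. \<forall>b\<in>Basis. x \<in> interior A \<longrightarrow> D' b x = D b x"
    using weak_gradient_unique[OF D' D] by (intro AE_finite_allI) auto
  ultimately have "AE x in lebesgue. ennreal (\<Sum>b\<in>Basis. (norm (D' b x))\<^sup>2) * indicator A x
      = ennreal (\<Sum>b\<in>Basis. (norm (D b x))\<^sup>2) * indicator (interior A) x"
    by eventually_elim (use interior_subset[of A] in \<open>auto simp: indicator_def\<close>)
  then have "(\<integral>\<^sup>+x. ennreal (\<Sum>b\<in>Basis. (norm (D' b x))\<^sup>2) * indicator A x \<partial>lebesgue)
      = (\<integral>\<^sup>+x. ennreal (\<Sum>b\<in>Basis. (norm (D b x))\<^sup>2) * indicator (interior A) x \<partial>lebesgue)"
    by (rule nn_integral_cong_AE)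
  moreover have "dirichlet_integral A u = (\<integral>\<^sup>+x. ennreal (\<Sum>b\<in>Basis. (norm (D' b x))\<^sup>2) * indicator A x \<partial>lebesgue)"
    using D A(1) by (auto simp: dirichlet_integral_def D'_def Let_def nn_integral_restrict_space)
  ultimately show ?thesis by simp
qed

lemma weak_gradient_cong:
  assumes "\<And>x. x \<in> interior A \<Longrightarrow> u x = v x"
  shows "weak_gradient A u = weak_gradient A v"
proof -
  have "locally_summable (interior A) u \<longleftrightarrow> locally_summable (interior A) v"
    unfolding locally_summable_def set_integrable_def
    by (intro all_cong imp_cong refl Bochner_Integration.integrable_cong) (use assms in \<open>auto simp: indicator_def subset_iff\<close>)
  moreover have "(LINT x:interior A|lebesgue. c x *\<^sub>R u x) = (LINT x:interior A|lebesgue. c x *\<^sub>R v x)" for c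
    unfolding set_lebesgue_integral_def
    by (intro Bochner_Integration.integral_cong) (use assms in \<open>auto simp: indicator_def\<close>)
  ultimately show ?thesis by (intro ext) (simp add: weak_gradient_def)
qed

text \<open>Both functions have literally the same weak gradients, so \<open>SOME\<close> picks the
  same one.\<close>

lemma dirichlet_integral_cong:
  assumes "\<And>x. x \<in> interior A \<Longrightarrow> u x = v x"
  shows "dirichlet_integral A u = dirichlet_integral A v"
  by (simp add: dirichlet_integral_def weak_gradient_cong[OF assms])

section \<open>Bounds and derivatives of smooth functions with compact support\<close>

lemma continuous_compact_support_bounded:
  fixes \<phi> :: "'a::euclidean_space \<Rightarrow> real"
  assumes "continuous_on UNIV \<phi>" "compact K" "\<And>x. x \<notin> K \<Longrightarrow> \<phi> x = 0"
  obtains M where "\<And>x. \<bar>\<phi> x\<bar> \<le> M"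
proof -
  obtain M where M: "\<And>x. x \<in> K \<Longrightarrow> \<bar>\<phi> x\<bar> \<le> M"
    using compact_imp_bounded[OF compact_continuous_image[OF continuous_on_subset[OF assms(1) subset_UNIV] assms(2)]]
    by (auto simp: bounded_iff)
  \<comment> \<open>\<open>M\<close> may be negative when \<open>K\<close> is empty, while \<phi> is
    0 off \<open>K\<close>.\<close>
  have "\<bar>\<phi> x\<bar> \<le> max M 0" for x using M[of x] assms(3)[of x] by (cases "x \<in> K") auto
  then show thesis by (rule that)
qed

lemma sum_Basis_inner_mult:
  fixes b :: "'a::euclidean_space"
  assumes "b \<in> Basis"
  shows "(\<Sum>b'\<in>Basis. (b \<bullet> b') * c b') = (c b :: real)"
proof -
  have "(\<Sum>b'\<in>Basis. (b \<bullet> b') * c b') = (\<Sum>b'\<in>Basis. if b' = b then c b' else 0)"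
    using assms by (intro sum.cong) (auto simp: inner_Basis)
  then show ?thesis using assms by simp
qed

lemma derivative_zero_outside_support:
  fixes \<phi> :: "'a::euclidean_space \<Rightarrow> real"
  assumes D: "\<And>x. (\<phi> has_derivative (\<lambda>h. \<Sum>b\<in>Basis. (h \<bullet> b) * D b x)) (at x)"
    and "closed K" "\<And>x. x \<notin> K \<Longrightarrow> \<phi> x = 0" "x \<notin> K" "b \<in> Basis"
  shows "D b x = 0"
proof -
  have "((\<lambda>_. 0) has_derivative (\<lambda>h. \<Sum>b\<in>Basis. (h \<bullet> b) * D b x)) (at x)"
    by (rule has_derivative_transform_within_open[OF D, where s = "- K"]) (use assms in auto)
  from has_derivative_unique[OF this has_derivative_const]
  have "(\<Sum>b'\<in>Basis. (b \<bullet> b') * D b' x) = 0" by metis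
  then show ?thesis using sum_Basis_inner_mult[OF assms(5), of "\<lambda>b'. D b' x"] by simp
qed

text \<open>The partial derivatives are continuous and vanish off \<open>K\<close>, hence are
  bounded; by the mean value inequality the sum of their bounds is a Lipschitz constant.\<close>

lemma C_k_compact_support_lipschitz:
  fixes \<phi> :: "'a::euclidean_space \<Rightarrow> real"
  assumes "C_k (Suc k) \<phi>" "compact K" "\<And>x. x \<notin> K \<Longrightarrow> \<phi> x = 0"
  obtains L where "L-lipschitz_on UNIV \<phi>"
proof -
  obtain D where D: "\<And>x. (\<phi> has_derivative (\<lambda>h. \<Sum>b\<in>Basis. (h \<bullet> b) * D b x)) (at x)"
    "\<And>b. b \<in> Basis \<Longrightarrow> C_k k (D b)"
    using C_k_SucE[OF assms(1)] by metis
  have "\<exists>M. \<forall>x. \<bar>D b x\<bar> \<le> M" if "b \<in> Basis" for b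
  proof (rule continuous_compact_support_bounded[OF C_k_imp_continuous_on[OF D(2)[OF that]] assms(2)])
    show "D b x = 0" if "x \<notin> K" for x
      by (rule derivative_zero_outside_support[where \<phi> = \<phi> and K = K])
        (rule D(1) compact_imp_closed assms(2,3) that \<open>b \<in> Basis\<close> | assumption)+
  qed auto
  then have "\<forall>b\<in>Basis. \<exists>M. \<forall>x. \<bar>D b x\<bar> \<le> M" by blast
  from bchoice[OF this] obtain M where M: "\<And>b x. b \<in> Basis \<Longrightarrow> \<bar>D b x\<bar> \<le> M b" by blast
  have M0: "0 \<le> (\<Sum>b\<in>(Basis::'a set). M b)" by (intro sum_nonneg order_trans[OF abs_ge_zero M])
  have "(\<Sum>b\<in>(Basis::'a set). M b)-lipschitz_on UNIV \<phi>"
  proof (rule lipschitz_onI[OF _ M0])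
    fix x y
    have "norm (\<phi> x - \<phi> y) \<le> (\<Sum>b\<in>(Basis::'a set). M b) * norm (x - y)"
    proof (rule differentiable_bound[of UNIV])
      fix z
      show "onorm (\<lambda>h. \<Sum>b\<in>Basis. (h \<bullet> b) * D b z) \<le> (\<Sum>b\<in>(Basis::'a set). M b)"
      proof (rule onorm_le)
        fix h
        have "norm (\<Sum>b\<in>Basis. (h \<bullet> b) * D b z) \<le> (\<Sum>b\<in>Basis. norm h * M b)"
          using M by (intro sum_norm_le) (auto simp: abs_mult intro!: mult_mono Basis_le_norm)
        then show "norm (\<Sum>b\<in>Basis. (h \<bullet> b) * D b z) \<le> (\<Sum>b\<in>Basis. M b) * norm h"
          by (simp add: sum_distrib_left mult.commute)
      qed
    qed (use D(1) in \<open>auto intro: has_derivative_at_withinI\<close>)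
    then show "dist (\<phi> x) (\<phi> y) \<le> (\<Sum>b\<in>(Basis::'a set). M b) * dist x y" by (simp add: dist_norm)
  qed
  then show thesis by (rule that)
qed

text \<open>Collects the partial derivatives in a vector, so that the value and the first
  derivatives of a test function at a point form one element of
  \<open>real \<times> 'a\<close>.\<close>

definition grad :: "('a::euclidean_space \<Rightarrow> real) \<Rightarrow> 'a \<Rightarrow> 'a" where
  "grad \<phi> x = (\<Sum>b\<in>Basis. frechet_derivative \<phi> (at x) b *\<^sub>R b)"

lemma grad_inner: "b \<in> Basis \<Longrightarrow> grad \<phi> x \<bullet> b = frechet_derivative \<phi> (at x) b"
  by (simp add: grad_def inner_sum_left inner_Basis if_distrib sum.delta cong: if_cong)

lemma frechet_derivative_Basis:
  fixes \<phi> :: "'a::euclidean_space \<Rightarrow> real"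
  assumes "(\<phi> has_derivative (\<lambda>h. \<Sum>b\<in>Basis. (h \<bullet> b) * D b x)) (at x)" "b \<in> Basis"
  shows "frechet_derivative \<phi> (at x) b = D b x"
proof -
  have "frechet_derivative \<phi> (at x) b = (\<Sum>b'\<in>Basis. (b \<bullet> b') * D b' x)"
    using frechet_derivative_at[OF assms(1)] by metis
  then show ?thesis using sum_Basis_inner_mult[OF assms(2), of "\<lambda>b'. D b' x"] by simp
qed

lemma test_function_derivative:
  assumes "\<phi> \<in> test_functions U" "b \<in> Basis"
  shows "C_k k (\<lambda>x. frechet_derivative \<phi> (at x) b)"
    and "x \<notin> closure {x. \<phi> x \<noteq> 0} \<Longrightarrow> frechet_derivative \<phi> (at x) b = 0"
proof -
  obtain D where D: "\<And>x. (\<phi> has_derivative (\<lambda>h. \<Sum>b\<in>Basis. (h \<bullet> b) * D b x)) (at x)"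
    "\<And>b. b \<in> Basis \<Longrightarrow> C_k k (D b)"
    using C_k_SucE[OF test_functionsD(1)[OF assms(1)]] by metis
  have eq: "(\<lambda>x. frechet_derivative \<phi> (at x) b) = D b"
    by (rule ext) (rule frechet_derivative_Basis[OF D(1) assms(2)])
  show "C_k k (\<lambda>x. frechet_derivative \<phi> (at x) b)" using eq D(2)[OF assms(2)] by simp
  show "frechet_derivative \<phi> (at x) b = 0" if "x \<notin> closure {x. \<phi> x \<noteq> 0}"
  proof -
    have "D b x = 0"
      by (rule derivative_zero_outside_support[where \<phi> = \<phi> and K = "closure {x. \<phi> x \<noteq> 0}"])
        (rule D(1) closed_closure test_functionsD(4)[OF assms(1)] assms(2) that | assumption)+
    then show ?thesis using fun_cong[OF eq, of x] by simp
  qed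
qed

lemma integrable_test_function_derivative_scaleR:
  assumes "\<phi> \<in> test_functions U" "b \<in> Basis" "locally_summable U g"
  shows "set_integrable lebesgue U (\<lambda>x. frechet_derivative \<phi> (at x) b *\<^sub>R g x)"
  by (rule integrable_continuous_scaleR[OF _ _ _ _ assms(3)])
    (rule C_k_imp_continuous_on[OF test_function_derivative(1)[OF assms(1,2)]]
      test_functionsD[OF assms(1)] test_function_derivative(2)[OF assms(1,2)] | assumption)+

section \<open>Linearity of the weak gradient\<close>

lemma weak_gradient_add:
  assumes "weak_gradient A u D" "weak_gradient A v D'"
  shows "weak_gradient A (\<lambda>x. u x + v x) (\<lambda>b x. D b x + D' b x)"
proof -
  have ls: "locally_summable (interior A) u" "locally_summable (interior A) v"
    "b \<in> Basis \<Longrightarrow> locally_summable (interior A) (D b)" "b \<in> Basis \<Longrightarrow> locally_summable (interior A) (D' b)" for b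
    using assms by (auto simp: weak_gradient_def)
  have "(LINT x:interior A|lebesgue. frechet_derivative \<phi> (at x) b *\<^sub>R (u x + v x)) =
           - (LINT x:interior A|lebesgue. \<phi> x *\<^sub>R (D b x + D' b x))"
    if \<phi>: "\<phi> \<in> test_functions (interior A)" and b: "b \<in> Basis" for \<phi> b
  proof -
    note [simp] = set_integral_add(2)[OF integrable_test_function_derivative_scaleR[OF \<phi> b ls(1)]
        integrable_test_function_derivative_scaleR[OF \<phi> b ls(2)]]
      set_integral_add(2)[OF integrable_test_function_scaleR[OF \<phi> ls(3)[OF b]] integrable_test_function_scaleR[OF \<phi> ls(4)[OF b]]]
    show ?thesis using assms \<phi> b by (simp add: weak_gradient_def scaleR_add_right)
  qed
  then show ?thesis using ls by (simp add: weak_gradient_def locally_summable_add)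
qed

lemma weak_gradient_scaleR:
  assumes "weak_gradient A u D"
  shows "weak_gradient A (\<lambda>x. c *\<^sub>R u x) (\<lambda>b x. c *\<^sub>R D b x)"
proof -
  have swap: "(LINT x:B|lebesgue. k x *\<^sub>R (c *\<^sub>R f x)) = c *\<^sub>R (LINT x:B|lebesgue. k x *\<^sub>R f x)"
    for B and k :: "'a \<Rightarrow> real" and f :: "'a \<Rightarrow> 'b"
    using set_integral_scaleR_right[of lebesgue B c "\<lambda>x. k x *\<^sub>R f x"]
    by (simp add: mult.commute[of c])
  show ?thesis using assms unfolding weak_gradient_def swap
    by (simp add: locally_summable_scaleR)
qed

section \<open>Fubini's theorem for the completed measure\<close>

text \<open>Lebesgue measure is complete, so a change on a null set preserves measurability. Slices
  and partial integrals of Lebesgue measurable functions are compared with Borel functions only up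
  to null sets, and this recovers their measurability.\<close>

lemma lebesgue_measurable_AE_cong:
  assumes g: "g \<in> borel_measurable borel" and ae: "AE x in lebesgue. f x = g x"
  shows "f \<in> borel_measurable lebesgue"
proof (rule borel_measurableI)
  fix S :: "'b set" assume "open S"
  then have S: "g -` S \<inter> space lebesgue \<in> sets lebesgue"
    using g by (intro measurable_sets[OF measurable_completion]) auto
  have "AE x in lebesgue. x \<in> g -` S \<inter> space lebesgue \<longleftrightarrow> x \<in> f -` S \<inter> space lebesgue"
    using ae by eventually_elim simp
  from completion.in_sets_AE[OF this S] show "f -` S \<inter> space lebesgue \<in> sets lebesgue"
    by simp
qed

lemma AE_lborel_prod:
  assumes "AE z in (lborel :: ('a::euclidean_space \<times> 'b::euclidean_space) measure). P z"
  shows "AE x in lborel. AE y in lborel. P (x, y)"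
  using assms unfolding lborel_prod[symmetric] by (rule lborel_pair.AE_pair)

text \<open>Lebesgue measure on a product is the completion of the product measure, not the product
  of the completions, so Fubini is applied to a Borel version \<open>g\<close>. Almost every slice
  of \<open>f\<close> agrees almost everywhere with the slice of \<open>g\<close>, which carries all
  three claims over.\<close>

lemma lebesgue_fubini:
  fixes f :: "'a::euclidean_space \<times> 'b::euclidean_space \<Rightarrow> 'c::euclidean_space"
  assumes f: "integrable lebesgue f"
  shows "AE x in lebesgue. integrable lebesgue (\<lambda>y. f (x, y))"
    and "integrable lebesgue (\<lambda>x. LINT y|lebesgue. f (x, y))"
    and "(LINT x|lebesgue. LINT y|lebesgue. f (x, y)) = integral\<^sup>L lebesgue f"
proof -
  obtain g where g: "g \<in> borel_measurable borel" and ae: "AE z in lborel. f z = g z"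
    using borel_version[OF borel_measurable_integrable[OF f]] .
  have gl: "g \<in> borel_measurable lebesgue" using g by (intro measurable_completion) simp
  have ae': "AE z in lebesgue. f z = g z" using ae by (rule AE_completion)
  have "integrable lebesgue g"
    using f integrable_cong_AE[OF borel_measurable_integrable[OF f] gl ae'] by simp
  then have "integrable lborel g" using g by (simp add: integrable_completion)
  then have gp: "integrable (lborel \<Otimes>\<^sub>M lborel) g" by (simp add: lborel_prod)
  have gx: "(\<lambda>y. g (x, y)) \<in> borel_measurable borel" for x
    using measurable_Pair2[of g lborel lborel borel] g by (simp add: lborel_prod)
  have slice: "AE x in lborel. AE y in lebesgue. f (x, y) = g (x, y)"
    using AE_lborel_prod[OF ae] by eventually_elim (rule AE_completion)
  have meas: "(\<lambda>y. f (x, y)) \<in> borel_measurable lebesgue" if "AE y in lebesgue. f (x, y) = g (x, y)" for x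
    using gx that by (rule lebesgue_measurable_AE_cong)
  have gxl: "(\<lambda>y. g (x, y)) \<in> borel_measurable lebesgue" for x
    using gx by (intro measurable_completion) simp
  have "AE x in lborel. integrable lebesgue (\<lambda>y. f (x, y))"
    using slice lborel_pair.AE_integrable_fst'[OF gp]
  proof eventually_elim
    case (elim x)
    then have "integrable lebesgue (\<lambda>y. g (x, y))" using gx by (simp add: integrable_completion)
    then show ?case using integrable_cong_AE[OF meas[OF elim(1)] gxl elim(1)] by simp
  qed
  then show "AE x in lebesgue. integrable lebesgue (\<lambda>y. f (x, y))" by (rule AE_completion)
  have "AE x in lborel. (LINT y|lebesgue. f (x, y)) = (LINT y|lborel. g (x, y))"
    using slice
  proof eventually_elim
    case (elim x)
    then show ?case
      using integral_cong_AE[OF meas[OF elim] gxl elim] gx by (simp add: integral_completion)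
  qed
  then have eq: "AE x in lebesgue. (LINT y|lebesgue. f (x, y)) = (LINT y|lborel. g (x, y))"
    by (rule AE_completion)
  have Gint: "integrable lborel (\<lambda>x. LINT y|lborel. g (x, y))" by (rule lborel_pair.integrable_fst'[OF gp])
  then have Gm: "(\<lambda>x. LINT y|lborel. g (x, y)) \<in> borel_measurable borel" by auto
  then have Gml: "(\<lambda>x. LINT y|lborel. g (x, y)) \<in> borel_measurable lebesgue" by (intro measurable_completion) simp
  note Fm = lebesgue_measurable_AE_cong[OF Gm eq]
  have "integrable lebesgue (\<lambda>x. LINT y|lborel. g (x, y))" using Gint Gm by (simp add: integrable_completion)
  then show "integrable lebesgue (\<lambda>x. LINT y|lebesgue. f (x, y))"
    using integrable_cong_AE[OF Fm Gml eq] by simp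
  have "(LINT x|lebesgue. LINT y|lebesgue. f (x, y)) = (LINT x|lborel. LINT y|lborel. g (x, y))"
    using integral_cong_AE[OF Fm Gml eq] Gm by (simp add: integral_completion)
  also have "\<dots> = integral\<^sup>L lborel g"
    using lborel_pair.integral_fst'[OF gp] by (simp add: lborel_prod)
  also have "\<dots> = integral\<^sup>L lebesgue f"
    using integral_cong_AE[OF borel_measurable_integrable[OF f] gl ae'] g by (simp add: integral_completion)
  finally show "(LINT x|lebesgue. LINT y|lebesgue. f (x, y)) = integral\<^sup>L lebesgue f" .
qed

lemma lebesgue_tonelli:
  fixes f :: "'a::euclidean_space \<times> 'b::euclidean_space \<Rightarrow> ennreal"
  assumes f: "f \<in> borel_measurable lebesgue"
  shows "(\<lambda>x. \<integral>\<^sup>+y. f (x, y) \<partial>lebesgue) \<in> borel_measurable lebesgue"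
    and "(\<integral>\<^sup>+x. \<integral>\<^sup>+y. f (x, y) \<partial>lebesgue \<partial>lebesgue) = integral\<^sup>N lebesgue f"
proof -
  obtain g where g: "g \<in> borel_measurable lborel" and ae: "AE z in lborel. f z = g z"
    using completion_ex_borel_measurable[OF f] by blast
  have gm: "g \<in> borel_measurable (lborel \<Otimes>\<^sub>M lborel)" using g by (simp add: lborel_prod)
  have "AE x in lborel. (\<integral>\<^sup>+y. f (x, y) \<partial>lebesgue) = (\<integral>\<^sup>+y. g (x, y) \<partial>lborel)"
    using AE_lborel_prod[OF ae] by eventually_elim (simp add: nn_integral_completion cong: nn_integral_cong_AE)
  then have eq: "AE x in lebesgue. (\<integral>\<^sup>+y. f (x, y) \<partial>lebesgue) = (\<integral>\<^sup>+y. g (x, y) \<partial>lborel)"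
    by (rule AE_completion)
  have "(\<lambda>x. \<integral>\<^sup>+y. g (x, y) \<partial>lborel) \<in> borel_measurable lborel"
    by (rule lborel.borel_measurable_nn_integral_fst[OF gm])
  then show "(\<lambda>x. \<integral>\<^sup>+y. f (x, y) \<partial>lebesgue) \<in> borel_measurable lebesgue"
    by (intro lebesgue_measurable_AE_cong[OF _ eq]) simp
  have "(\<integral>\<^sup>+x. \<integral>\<^sup>+y. f (x, y) \<partial>lebesgue \<partial>lebesgue) = (\<integral>\<^sup>+x. \<integral>\<^sup>+y. g (x, y) \<partial>lborel \<partial>lborel)"
    using nn_integral_cong_AE[OF eq] by (simp add: nn_integral_completion)
  also have "\<dots> = integral\<^sup>N lborel g"
    using lborel.nn_integral_fst[OF gm] by (simp add: lborel_prod)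
  also have "\<dots> = integral\<^sup>N lebesgue f"
    using nn_integral_cong_AE[OF ae] by (simp add: nn_integral_completion)
  finally show "(\<integral>\<^sup>+x. \<integral>\<^sup>+y. f (x, y) \<partial>lebesgue \<partial>lebesgue) = integral\<^sup>N lebesgue f" .
qed

section \<open>Countably many test functions\<close>

text \<open>Equicontinuity: the common Lipschitz constant moves the comparison from \<open>x\<close>
  to a nearby point of \<open>Q\<close> at a cost independent of \<open>n\<close>.\<close>

lemma lipschitz_tendsto_dense:
  fixes f :: "nat \<Rightarrow> 'a::metric_space \<Rightarrow> 'b::metric_space"
  assumes "\<And>n. L-lipschitz_on UNIV (f n)" "L-lipschitz_on UNIV g" "closure Q = UNIV"
    and "\<And>q. q \<in> Q \<Longrightarrow> (\<lambda>n. f n q) \<longlonglongrightarrow> g q"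
  shows "(\<lambda>n. f n x) \<longlonglongrightarrow> g x"
proof (rule tendstoI)
  fix e :: real assume e: "e > 0"
  have L: "0 \<le> L" using assms(2) by (rule lipschitz_on_nonneg)
  \<comment> \<open>The summand 1 keeps the denominator positive when \<open>L = 0\<close>.\<close>
  define d where "d = e / (3 * (L + 1))"
  have d: "d > 0" "L * d \<le> e / 3" using e L by (auto simp: d_def field_simps)
  have "x \<in> closure Q" using assms(3) by simp
  then obtain q where q: "q \<in> Q" "dist q x < d" using d(1) by (auto simp: closure_approachable)
  have Lq: "dist (h x) (h q) \<le> e / 3" if "L-lipschitz_on UNIV h" for h :: "'a \<Rightarrow> 'b"
  proof -
    have "dist (h x) (h q) \<le> L * dist x q" using that by (rule lipschitz_onD) auto
    also have "\<dots> \<le> L * d" using q(2) L by (intro mult_left_mono) (auto simp: dist_commute)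
    finally show ?thesis using d by simp
  qed
  have "eventually (\<lambda>n. dist (f n q) (g q) < e / 3) sequentially"
    using assms(4)[OF q(1)] e by (intro tendstoD) auto
  then show "eventually (\<lambda>n. dist (f n x) (g x) < e) sequentially"
  proof eventually_elim
    case (elim n)
    have "dist (f n x) (g x) \<le> dist (f n x) (f n q) + dist (f n q) (g q) + dist (g q) (g x)"
      using dist_triangle[of "f n x" "g x" "f n q"] dist_triangle[of "f n q" "g x" "g q"] by linarith
    then show ?case using Lq[OF assms(1)[of n]] Lq[OF assms(2)] elim by (simp add: dist_commute)
  qed
qed

text \<open>The common Lipschitz constant upgrades convergence of test functions and their derivatives on a
  countable dense set, which is a separable topology, to bounded convergence everywhere.\<close>

definition bounded_tests :: "'a::euclidean_space set \<Rightarrow> real \<Rightarrow> ('a \<Rightarrow> real) set" where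
  "bounded_tests U M = {\<phi> \<in> test_functions U. (\<forall>x. \<bar>\<phi> x\<bar> \<le> M) \<and> M-lipschitz_on UNIV \<phi> \<and>
     (\<forall>b\<in>Basis. (\<forall>x. \<bar>frechet_derivative \<phi> (at x) b\<bar> \<le> M) \<and>
        M-lipschitz_on UNIV (\<lambda>x. frechet_derivative \<phi> (at x) b))}"

text \<open>\<phi> and its partial derivatives vanish off the same compact set and can be
  differentiated once more, which gives finitely many bounds and Lipschitz constants. Integer levels
  keep the union countable.\<close>

lemma test_functions_eq_UN_bounded_tests: "test_functions U = (\<Union>n. bounded_tests U (real n))"
proof
  show "test_functions U \<subseteq> (\<Union>n. bounded_tests U (real n))"
  proof
    fix \<phi> assume \<phi>: "\<phi> \<in> test_functions U"
    let ?K = "closure {x. \<phi> x \<noteq> 0}"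
    have bnd: "\<exists>M. (\<forall>x. \<bar>\<psi> x\<bar> \<le> M) \<and> M-lipschitz_on UNIV \<psi>"
      if 1: "C_k (Suc 0) \<psi>" and 2: "\<And>x. x \<notin> ?K \<Longrightarrow> \<psi> x = 0" for \<psi>
    proof -
      obtain M where M: "\<And>x. \<bar>\<psi> x\<bar> \<le> M"
        using continuous_compact_support_bounded[OF C_k_imp_continuous_on[OF 1] test_functionsD(2)[OF \<phi>] 2] by blast
      obtain L where "L-lipschitz_on UNIV \<psi>"
        using C_k_compact_support_lipschitz[OF 1 test_functionsD(2)[OF \<phi>] 2] .
      then have "(max L M)-lipschitz_on UNIV \<psi>" by (rule lipschitz_on_le) simp
      then show ?thesis using M by (intro exI[of _ "max L M"]) (simp add: le_max_iff_disj)
    qed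
    obtain M0 where M0: "\<And>x. \<bar>\<phi> x\<bar> \<le> M0" "M0-lipschitz_on UNIV \<phi>"
      using bnd[OF test_functionsD(1,4)[OF \<phi>]] by blast
    have "\<forall>b\<in>Basis. \<exists>M. (\<forall>x. \<bar>frechet_derivative \<phi> (at x) b\<bar> \<le> M) \<and> M-lipschitz_on UNIV (\<lambda>x. frechet_derivative \<phi> (at x) b)"
      using bnd[OF test_function_derivative[OF \<phi>]] by blast
    from bchoice[OF this] obtain M1 where
      M1: "\<And>b x. b \<in> Basis \<Longrightarrow> \<bar>frechet_derivative \<phi> (at x) b\<bar> \<le> M1 b"
        "\<And>b. b \<in> Basis \<Longrightarrow> (M1 b)-lipschitz_on UNIV (\<lambda>x. frechet_derivative \<phi> (at x) b)" by blast
    obtain n where n: "max M0 (Max (M1 ` Basis)) \<le> real n" using real_arch_simple by blast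
    have le: "M0 \<le> real n" "\<And>b. b \<in> Basis \<Longrightarrow> M1 b \<le> real n"
      using n by (auto simp: Max_le_iff)
    have "\<phi> \<in> bounded_tests U (real n)"
      unfolding bounded_tests_def
      by (intro CollectI conjI ballI allI \<phi> order_trans[OF M0(1)] lipschitz_on_le[OF M0(2)]
          order_trans[OF M1(1)] lipschitz_on_le[OF M1(2)] le)
    then show "\<phi> \<in> (\<Union>n. bounded_tests U (real n))" by blast
  qed
qed (auto simp: bounded_tests_def)

text \<open>A test function is recorded by its values and gradients on a countable dense set, that
  is, by a point in a countable product of copies of \<open>real \<times> 'a\<close>. Every subset
  of this product is separable, and the common Lipschitz constant extends convergence from the dense
  set to all points.\<close>

lemma bounded_tests_countable_dense:
  fixes U :: "'a::euclidean_space set"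
  obtains \<Phi> where "countable \<Phi>" "\<Phi> \<subseteq> bounded_tests U M"
    "\<And>\<phi>. \<phi> \<in> bounded_tests U M \<Longrightarrow> \<exists>\<psi>. (\<forall>n. \<psi> n \<in> \<Phi>) \<and> (\<forall>x. (\<lambda>n. \<psi> n x) \<longlonglongrightarrow> \<phi> x) \<and>
       (\<forall>b\<in>Basis. \<forall>x. (\<lambda>n. frechet_derivative (\<psi> n) (at x) b) \<longlonglongrightarrow> frechet_derivative \<phi> (at x) b)"
proof -
  let ?T = "bounded_tests U M"
  obtain Q :: "'a set" where Q: "countable Q" "\<And>X. open X \<Longrightarrow> X \<noteq> {} \<Longrightarrow> \<exists>q\<in>Q. q \<in> X"
    using countable_dense_setE by blast
  have Q0: "Q \<noteq> {}" using Q(2)[of UNIV] by auto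
  have dense: "closure Q = UNIV"
    using Q(2) by (auto simp: closure_iff_nhds_not_empty closure_def islimpt_def)
  define q where "q = from_nat_into Q"
  define E :: "('a \<Rightarrow> real) \<Rightarrow> nat \<Rightarrow> real \<times> 'a" where "E \<phi> k = (\<phi> (q k), grad \<phi> (q k))" for \<phi> k
  \<comment> \<open>\<open>C\<close> lies inside the image of \<open>E\<close> and is dense in it,
    so its elements can be pulled back to members of \<open>bounded_tests U M\<close>.\<close>
  obtain C where C: "countable C" "C \<subseteq> E ` ?T" "E ` ?T \<subseteq> closure C" by (rule separable)
  show thesis
  proof
    show "countable (inv_into ?T E ` C)" using C(1) by simp
    show sub: "inv_into ?T E ` C \<subseteq> ?T" using C(2) by (auto intro: inv_into_into)
    fix \<phi> assume \<phi>: "\<phi> \<in> ?T"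
    then have "E \<phi> \<in> closure C" using C(3) by blast
    then obtain c where c: "\<And>n. c n \<in> C" "c \<longlonglongrightarrow> E \<phi>" by (auto simp: closure_sequential)
    define \<psi> where "\<psi> n = inv_into ?T E (c n)" for n
    have \<psi>\<Phi>: "\<psi> n \<in> inv_into ?T E ` C" for n using c(1) by (simp add: \<psi>_def)
    then have \<psi>: "\<psi> n \<in> ?T" for n using sub by blast
    have E\<psi>: "E (\<psi> n) = c n" for n
      unfolding \<psi>_def by (rule f_inv_into_f[OF subsetD[OF C(2) c(1)]])
    have lim: "(\<lambda>n. E (\<psi> n) k) \<longlonglongrightarrow> E \<phi> k" for k
    proof -
      have "continuous_on UNIV (\<lambda>f :: nat \<Rightarrow> real \<times> 'a. f k)" by (rule continuous_on_product_coordinates)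
      then have "isCont (\<lambda>f :: nat \<Rightarrow> real \<times> 'a. f k) (E \<phi>)"
        using continuous_on_eq_continuous_at[OF open_UNIV] by blast
      from isCont_tendsto_compose[OF this c(2)] show ?thesis by (simp add: E\<psi>)
    qed
    have at_Q: "\<exists>k. x = q k" if "x \<in> Q" for x
      using from_nat_into_surj[OF Q(1) that] by (auto simp: q_def)
    have "(\<lambda>n. \<psi> n x) \<longlonglongrightarrow> \<phi> x" for x
    proof (rule lipschitz_tendsto_dense[OF _ _ dense])
      show "(\<lambda>n. \<psi> n x) \<longlonglongrightarrow> \<phi> x" if "x \<in> Q" for x
        using at_Q[OF that] tendsto_fst[OF lim] by (auto simp: E_def)
    qed (use \<phi> \<psi> in \<open>auto simp: bounded_tests_def\<close>)
    moreover have "(\<lambda>n. frechet_derivative (\<psi> n) (at x) b) \<longlonglongrightarrow> frechet_derivative \<phi> (at x) b"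
      if b: "b \<in> Basis" for b x
    proof (rule lipschitz_tendsto_dense[where f = "\<lambda>n x. frechet_derivative (\<psi> n) (at x) b"
          and g = "\<lambda>x. frechet_derivative \<phi> (at x) b", OF _ _ dense])
      show "(\<lambda>n. frechet_derivative (\<psi> n) (at x) b) \<longlonglongrightarrow> frechet_derivative \<phi> (at x) b" if "x \<in> Q" for x
        using at_Q[OF that] tendsto_inner[OF tendsto_snd[OF lim] tendsto_const[of b]]
        by (auto simp: E_def grad_inner[OF b])
    qed (use b \<phi> \<psi> in \<open>auto simp: bounded_tests_def\<close>)
    ultimately show "\<exists>\<psi>. (\<forall>n. \<psi> n \<in> inv_into ?T E ` C) \<and> (\<forall>x. (\<lambda>n. \<psi> n x) \<longlonglongrightarrow> \<phi> x) \<and>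
       (\<forall>b\<in>Basis. \<forall>x. (\<lambda>n. frechet_derivative (\<psi> n) (at x) b) \<longlonglongrightarrow> frechet_derivative \<phi> (at x) b)"
      using \<psi>\<Phi> by blast
  qed
qed

section \<open>Integrals against bounded factors\<close>

lemma set_integrable_imp_locally_summable:
  "set_integrable lebesgue U u \<Longrightarrow> locally_summable U u"
  unfolding locally_summable_def
  by (auto intro!: set_integrable_subset[of lebesgue U u] sets_completionI_sets borel_compact)

lemma continuous_imp_lebesgue_measurable:
  fixes f :: "'a::euclidean_space \<Rightarrow> 'b::topological_space"
  assumes "continuous_on UNIV f" shows "f \<in> borel_measurable lebesgue"
  using borel_measurable_continuous_onI[OF assms] by (intro measurable_completion) simp

lemma integrable_bounded_scaleR:
  fixes f :: "'a \<Rightarrow> 'b::{banach, second_countable_topology}"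
  assumes "integrable M f" "c \<in> borel_measurable M" "\<And>x. \<bar>c x\<bar> \<le> C"
  shows "integrable M (\<lambda>x. c x *\<^sub>R f x)"
proof (rule Bochner_Integration.integrable_bound)
  show "integrable M (\<lambda>x. C *\<^sub>R f x)" using integrable_scaleR_right[of C, OF assms(1)] .
  show "(\<lambda>x. c x *\<^sub>R f x) \<in> borel_measurable M"
    using assms(2) borel_measurable_integrable[OF assms(1)] by (rule borel_measurable_scaleR)
  show "AE x in M. norm (c x *\<^sub>R f x) \<le> norm (C *\<^sub>R f x)"
    using order_trans[OF assms(3) abs_ge_self] by (intro AE_I2) (auto intro!: mult_right_mono)
qed

lemma set_integrable_bounded_scaleR:
  fixes f :: "'a \<Rightarrow> 'b::{banach, second_countable_topology}"
  assumes "set_integrable M A f" "c \<in> borel_measurable M" "\<And>x. \<bar>c x\<bar> \<le> C"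
  shows "set_integrable M A (\<lambda>x. c x *\<^sub>R f x)"
  using integrable_bounded_scaleR[OF assms(1)[unfolded set_integrable_def] assms(2,3)]
  unfolding set_integrable_def scaleR_left_commute[of "indicator A _"] .

lemma set_integral_scaleR_tendsto:
  fixes f :: "'a \<Rightarrow> 'b::{banach, second_countable_topology}"
  assumes f: "set_integrable M A f" and c: "\<And>n. c n \<in> borel_measurable M" "\<And>n x. \<bar>c n x\<bar> \<le> C"
    and lim: "\<And>x. (\<lambda>n. c n x) \<longlonglongrightarrow> d x"
  shows "(\<lambda>n. LINT x:A|M. c n x *\<^sub>R f x) \<longlonglongrightarrow> (LINT x:A|M. d x *\<^sub>R f x)"
  unfolding set_lebesgue_integral_def scaleR_left_commute[of "indicator A _"]
proof (rule integral_dominated_convergence[where w = "\<lambda>x. norm (C *\<^sub>R (indicator A x *\<^sub>R f x))"])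
  note int = f[unfolded set_integrable_def]
  have d: "d \<in> borel_measurable M" using c(1) lim by (rule borel_measurable_LIMSEQ_real[rotated])
  show "(\<lambda>x. d x *\<^sub>R (indicator A x *\<^sub>R f x)) \<in> borel_measurable M"
    using d borel_measurable_integrable[OF int] by (rule borel_measurable_scaleR)
  show "(\<lambda>x. c n x *\<^sub>R (indicator A x *\<^sub>R f x)) \<in> borel_measurable M" for n
    using c(1) borel_measurable_integrable[OF int] by (rule borel_measurable_scaleR)
  show "integrable M (\<lambda>x. norm (C *\<^sub>R (indicator A x *\<^sub>R f x)))"
    using integrable_scaleR_right[of C, OF int] by (rule integrable_norm)
  show "AE x in M. (\<lambda>n. c n x *\<^sub>R (indicator A x *\<^sub>R f x)) \<longlonglongrightarrow> d x *\<^sub>R (indicator A x *\<^sub>R f x)"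
    by (intro AE_I2 tendsto_scaleR tendsto_const lim)
  show "AE x in M. norm (c n x *\<^sub>R (indicator A x *\<^sub>R f x)) \<le> norm (C *\<^sub>R (indicator A x *\<^sub>R f x))" for n
    unfolding norm_scaleR[of "c n _"] norm_scaleR[of C]
    by (intro AE_I2 mult_right_mono order_trans[OF c(2) abs_ge_self]) simp
qed

lemma test_function_outside:
  assumes "\<phi> \<in> test_functions U" "x \<notin> U"
  shows "\<phi> x = 0"
  by (rule test_functionsD(4)[OF assms(1)]) (use test_functionsD(3)[OF assms(1)] assms(2) in blast)

lemma test_function_bounded:
  assumes "\<phi> \<in> test_functions U"
  obtains M where "\<And>x. \<bar>\<phi> x\<bar> \<le> M"
  using continuous_compact_support_bounded[OF test_functionsD(5,2,4)[OF assms]] by blast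

lemma test_function_derivative_bounded:
  assumes "\<phi> \<in> test_functions U" "b \<in> Basis"
  obtains M where "\<And>x. \<bar>frechet_derivative \<phi> (at x) b\<bar> \<le> M"
  using continuous_compact_support_bounded[OF C_k_imp_continuous_on[OF test_function_derivative(1)[OF assms]]
      test_functionsD(2)[OF assms(1)] test_function_derivative(2)[OF assms]] by blast

lemma test_function_measurable:
  assumes "\<phi> \<in> test_functions U"
  shows "\<phi> \<in> borel_measurable lebesgue"
    "b \<in> Basis \<Longrightarrow> (\<lambda>x. frechet_derivative \<phi> (at x) b) \<in> borel_measurable lebesgue"
  using test_functionsD(5)[OF assms] C_k_imp_continuous_on[OF test_function_derivative(1)[OF assms]]
  by (auto intro!: continuous_imp_lebesgue_measurable)

text \<open>The family is fixed before \<open>u\<close> and \<open>D\<close>, so one countable union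
  of null sets serves all slices at once. Integrability on the whole interior is assumed because the
  approximants of a test function share a bound but no compact set containing their supports;
  dominated convergence therefore runs over the entire interior.\<close>

lemma weak_gradient_countable_tests:
  fixes A :: "'a::euclidean_space set"
  obtains \<Phi> where "countable \<Phi>" "\<Phi> \<subseteq> test_functions (interior A)"
    "\<And>(u :: 'a \<Rightarrow> 'b::euclidean_space) D.
      set_integrable lebesgue (interior A) u \<Longrightarrow> (\<And>b. b \<in> Basis \<Longrightarrow> set_integrable lebesgue (interior A) (D b)) \<Longrightarrow>
      (\<And>b \<phi>. b \<in> Basis \<Longrightarrow> \<phi> \<in> \<Phi> \<Longrightarrow>
        (LINT x:interior A|lebesgue. frechet_derivative \<phi> (at x) b *\<^sub>R u x) =
           - (LINT x:interior A|lebesgue. \<phi> x *\<^sub>R D b x)) \<Longrightarrow> weak_gradient A u D"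
proof -
  let ?U = "interior A"
  define approx where "approx \<Phi> \<phi> \<longleftrightarrow> (\<exists>\<psi>. (\<forall>n. \<psi> n \<in> \<Phi>) \<and> (\<forall>x. (\<lambda>n. \<psi> n x) \<longlonglongrightarrow> \<phi> x) \<and>
       (\<forall>b\<in>Basis. \<forall>x. (\<lambda>n. frechet_derivative (\<psi> n) (at x) b) \<longlonglongrightarrow> frechet_derivative \<phi> (at x) b))"
    for \<Phi> and \<phi> :: "'a \<Rightarrow> real"
  have "\<exists>\<Phi>. countable \<Phi> \<and> \<Phi> \<subseteq> bounded_tests ?U (real N) \<and> (\<forall>\<phi> \<in> bounded_tests ?U (real N). approx \<Phi> \<phi>)" for N
    by (rule bounded_tests_countable_dense[of ?U "real N", folded approx_def]) blast
  from choice[OF allI[OF this]] obtain \<Phi> where "\<forall>N. countable (\<Phi> N) \<and> \<Phi> N \<subseteq> bounded_tests ?U (real N) \<and>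
      (\<forall>\<phi> \<in> bounded_tests ?U (real N). approx (\<Phi> N) \<phi>)"
    by (rule exE)
  then have \<Phi>: "\<And>N. countable (\<Phi> N)" "\<And>N. \<Phi> N \<subseteq> bounded_tests ?U (real N)"
    and dense: "\<And>N \<phi>. \<phi> \<in> bounded_tests ?U (real N) \<Longrightarrow> approx (\<Phi> N) \<phi>"
    by blast+
  show thesis
  proof
    show "countable (\<Union>N. \<Phi> N)" using \<Phi>(1) by blast
    show "(\<Union>N. \<Phi> N) \<subseteq> test_functions ?U" using \<Phi>(2) by (auto simp: bounded_tests_def)
    fix u :: "'a \<Rightarrow> 'b" and D
    assume u: "set_integrable lebesgue ?U u" and D: "\<And>b. b \<in> Basis \<Longrightarrow> set_integrable lebesgue ?U (D b)"
      and eq: "\<And>b \<phi>. b \<in> Basis \<Longrightarrow> \<phi> \<in> (\<Union>N. \<Phi> N) \<Longrightarrow>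
        (LINT x:?U|lebesgue. frechet_derivative \<phi> (at x) b *\<^sub>R u x) = - (LINT x:?U|lebesgue. \<phi> x *\<^sub>R D b x)"
    have "(LINT x:?U|lebesgue. frechet_derivative \<phi> (at x) b *\<^sub>R u x) = - (LINT x:?U|lebesgue. \<phi> x *\<^sub>R D b x)"
      if b: "b \<in> Basis" and \<phi>: "\<phi> \<in> test_functions ?U" for b \<phi>
    proof -
      obtain N where "\<phi> \<in> bounded_tests ?U (real N)"
        using \<phi> unfolding test_functions_eq_UN_bounded_tests by blast
      from dense[OF this] obtain \<psi> where \<psi>: "\<And>n. \<psi> n \<in> \<Phi> N" "\<And>x. (\<lambda>n. \<psi> n x) \<longlonglongrightarrow> \<phi> x"
        "\<And>x. (\<lambda>n. frechet_derivative (\<psi> n) (at x) b) \<longlonglongrightarrow> frechet_derivative \<phi> (at x) b"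
        using b unfolding approx_def by blast
      have \<psi>b: "\<psi> n \<in> bounded_tests ?U (real N)" for n using \<psi>(1) \<Phi>(2) by blast
      then have \<psi>t: "\<psi> n \<in> test_functions ?U" for n by (simp add: bounded_tests_def)
      have bnd: "\<bar>\<psi> n x\<bar> \<le> real N" "\<bar>frechet_derivative (\<psi> n) (at x) b\<bar> \<le> real N" for n x
        using \<psi>b[of n] b by (auto simp: bounded_tests_def)
      have "(\<lambda>n. LINT x:?U|lebesgue. frechet_derivative (\<psi> n) (at x) b *\<^sub>R u x)
          \<longlonglongrightarrow> (LINT x:?U|lebesgue. frechet_derivative \<phi> (at x) b *\<^sub>R u x)"
        by (rule set_integral_scaleR_tendsto[OF u test_function_measurable(2)[OF \<psi>t b] bnd(2) \<psi>(3)])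
      moreover have "(\<lambda>n. - (LINT x:?U|lebesgue. \<psi> n x *\<^sub>R D b x)) \<longlonglongrightarrow> - (LINT x:?U|lebesgue. \<phi> x *\<^sub>R D b x)"
        by (intro tendsto_minus set_integral_scaleR_tendsto[OF D[OF b] test_function_measurable(1)[OF \<psi>t] bnd(1) \<psi>(2)])
      moreover have "(LINT x:?U|lebesgue. frechet_derivative (\<psi> n) (at x) b *\<^sub>R u x) = - (LINT x:?U|lebesgue. \<psi> n x *\<^sub>R D b x)" for n
        using \<psi>(1) by (intro eq[OF b]) blast
      ultimately show ?thesis using LIMSEQ_unique by simp
    qed
    then show "weak_gradient A u D"
      unfolding weak_gradient_def using u D set_integrable_imp_locally_summable by blast
  qed
qed

section \<open>Slices of weakly differentiable functions\<close>

lemma tensor_test_function: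
  assumes \<psi>: "\<psi> \<in> test_functions I" and \<phi>: "\<phi> \<in> test_functions V"
  shows "(\<lambda>z. \<psi> (fst z) * \<phi> (snd z)) \<in> test_functions (I \<times> V)"
proof -
  have "C_k k (\<lambda>z. \<psi> (fst z) * \<phi> (snd z))" for k
    using C_k_compose_affine[OF linear_fst test_functionsD(1)[OF \<psi>], of k 0]
      C_k_compose_affine[OF linear_snd test_functionsD(1)[OF \<phi>], of k 0]
    by (intro C_k_mult) simp_all
  moreover have sub: "closure {z. \<psi> (fst z) * \<phi> (snd z) \<noteq> 0} \<subseteq> closure {x. \<psi> x \<noteq> 0} \<times> closure {x. \<phi> x \<noteq> 0}"
    using closure_subset[of "{x. \<psi> x \<noteq> 0}"] closure_subset[of "{x. \<phi> x \<noteq> 0}"]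
    by (intro closure_minimal closed_Times closed_closure) auto
  moreover have "compact (closure {z. \<psi> (fst z) * \<phi> (snd z) \<noteq> 0})"
    by (rule compact_closure[THEN iffD2, OF bounded_subset[OF _ subset_trans[OF closure_subset sub]]])
      (intro bounded_Times compact_imp_bounded test_functionsD(2)[OF \<psi>] test_functionsD(2)[OF \<phi>])
  ultimately show ?thesis
    using test_functionsD(3)[OF \<psi>] test_functionsD(3)[OF \<phi>] by (auto simp: test_functions_def)
qed

lemma test_function_has_derivative:
  assumes "\<phi> \<in> test_functions V"
  shows "(\<phi> has_derivative frechet_derivative \<phi> (at x)) (at x)"
proof -
  obtain D where "\<And>x. (\<phi> has_derivative (\<lambda>h. \<Sum>b\<in>Basis. (h \<bullet> b) * D b x)) (at x)"
    "\<And>b. b \<in> Basis \<Longrightarrow> C_k 0 (D b)"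
    using C_k_SucE[OF test_functionsD(1)[OF assms, of "Suc 0"]] by metis
  from this(1) have "\<phi> differentiable (at x)" by (rule differentiableI)
  then show ?thesis by (simp add: frechet_derivative_works)
qed

text \<open>In a direction \<open>(0, b)\<close> only the second factor is differentiated, so \<psi>
  enters the weak identity as a mere weight in the first variable.\<close>

lemma tensor_test_function_derivative:
  assumes "\<psi> \<in> test_functions I" "\<phi> \<in> test_functions V"
  shows "frechet_derivative (\<lambda>z. \<psi> (fst z) * \<phi> (snd z)) (at z) (0, b) = \<psi> (fst z) * frechet_derivative \<phi> (at (snd z)) b"
proof -
  let ?d = "\<lambda>h. \<psi> (fst z) * frechet_derivative \<phi> (at (snd z)) (snd h) + frechet_derivative \<psi> (at (fst z)) (fst h) * \<phi> (snd z)"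
  have "((\<lambda>z. \<psi> (fst z) * \<phi> (snd z)) has_derivative ?d) (at z)"
    by (intro has_derivative_mult
        has_derivative_compose[OF has_derivative_fst[OF has_derivative_ident] test_function_has_derivative[OF assms(1)]]
        has_derivative_compose[OF has_derivative_snd[OF has_derivative_ident] test_function_has_derivative[OF assms(2)]])
  then have "frechet_derivative (\<lambda>z. \<psi> (fst z) * \<phi> (snd z)) (at z) = ?d"
    by (rule frechet_derivative_at[symmetric])
  moreover have "frechet_derivative \<psi> (at (fst z)) 0 = 0"
    using has_derivative_bounded_linear[OF test_function_has_derivative[OF assms(1)]] by (rule linear_simps(3))
  ultimately show ?thesis by simp
qed

text \<open>For one test function \<phi> and one direction \<open>b\<close>, let g(t) be the defect
  of the weak identity on the slice at \<open>t\<close>. Testing on the product with \<psi>(t)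
  \<phi>(x) shows that the integral of \<psi> g vanishes for all \<psi>, so g = 0 almost everywhere
  on \<open>I\<close>. The countable family of tests then leaves a single null set of times.\<close>

lemma weak_gradient_slice:
  fixes u :: "'a::euclidean_space \<times> 'b::euclidean_space \<Rightarrow> 'c::euclidean_space"
  assumes wg: "weak_gradient A u D" and A: "interior A = I \<times> interior B" and I: "open I"
    and u: "set_integrable lebesgue (interior A) u"
    and D: "\<And>b. b \<in> Basis \<Longrightarrow> set_integrable lebesgue (interior A) (D (0, b))"
  shows "AE t in lebesgue. t \<in> I \<longrightarrow> weak_gradient B (\<lambda>x. u (t, x)) (\<lambda>b x. D (0, b) (t, x))"
proof -
  let ?V = "interior B"
  have ind: "indicat_real (interior A) (t, x) = indicat_real ?V x" if "t \<in> I" for t x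
    using that A by (auto simp: indicator_def)
  have slice: "AE t in lebesgue. t \<in> I \<longrightarrow> set_integrable lebesgue ?V (\<lambda>x. w (t, x))"
    if "set_integrable lebesgue (interior A) w" for w :: "'a \<times> 'b \<Rightarrow> 'c"
    using lebesgue_fubini(1)[OF that[unfolded set_integrable_def]]
    by eventually_elim (auto simp only: ind set_integrable_def)
  have id: "AE t in lebesgue. t \<in> I \<longrightarrow>
      (LINT x:?V|lebesgue. frechet_derivative \<phi> (at x) b *\<^sub>R u (t, x)) = - (LINT x:?V|lebesgue. \<phi> x *\<^sub>R D (0, b) (t, x))"
    if b: "b \<in> Basis" and \<phi>: "\<phi> \<in> test_functions ?V" for b \<phi>
  proof -
    \<comment> \<open>Both integrands are extended by zero off \<open>interior A\<close>, so that
      Fubini applies on the whole product space.\<close>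
    define u' where "u' z = frechet_derivative \<phi> (at (snd z)) b *\<^sub>R (indicat_real (interior A) z *\<^sub>R u z)" for z
    define D' where "D' z = \<phi> (snd z) *\<^sub>R (indicat_real (interior A) z *\<^sub>R D (0, b) z)" for z
    obtain M where M: "\<And>x. \<bar>frechet_derivative \<phi> (at x) b\<bar> \<le> M" by (rule test_function_derivative_bounded[OF \<phi> b]) blast
    obtain M' where M': "\<And>x. \<bar>\<phi> x\<bar> \<le> M'" by (rule test_function_bounded[OF \<phi>]) blast
    have snd: "(\<lambda>z. f (snd z)) \<in> borel_measurable lebesgue" if "continuous_on UNIV f" for f :: "'b \<Rightarrow> real"
      by (intro continuous_imp_lebesgue_measurable continuous_on_compose2[OF that] continuous_intros) simp
    have u': "integrable lebesgue u'"
      unfolding u'_def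
      by (rule integrable_bounded_scaleR[OF u[unfolded set_integrable_def]
            snd[OF C_k_imp_continuous_on[OF test_function_derivative(1)[OF \<phi> b]]] M])
    have D': "integrable lebesgue D'"
      unfolding D'_def
      by (rule integrable_bounded_scaleR[OF D[OF b, unfolded set_integrable_def] snd[OF test_functionsD(5)[OF \<phi>]] M'])
    define g where "g t = (LINT x|lebesgue. u' (t, x) + D' (t, x))" for t
    have int: "integrable lebesgue (\<lambda>z. u' z + D' z)" using u' D' by (rule Bochner_Integration.integrable_add)
    have g: "integrable lebesgue g" unfolding g_def by (rule lebesgue_fubini(2)[OF int])
    have "AE t in lebesgue. t \<in> I \<longrightarrow> g t = 0"
    proof (rule fundamental_lemma[OF I])
      have "set_integrable lebesgue I g"
        unfolding set_integrable_def using g I by (intro integrable_mult_indicator) auto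
      then show "locally_summable I g" by (rule set_integrable_imp_locally_summable)
      fix \<psi> :: "'a \<Rightarrow> real" assume \<psi>: "\<psi> \<in> test_functions I"
      let ?p = "\<lambda>z. \<psi> (fst z) * \<phi> (snd z)"
      have p: "?p \<in> test_functions (interior A)" using tensor_test_function[OF \<psi> \<phi>] A by simp
      obtain N where N: "\<And>x. \<bar>\<psi> x\<bar> \<le> N" by (rule test_function_bounded[OF \<psi>]) blast
      have fst: "(\<lambda>z :: 'a \<times> 'b. \<psi> (fst z)) \<in> borel_measurable lebesgue"
        by (intro continuous_imp_lebesgue_measurable continuous_on_compose2[OF test_functionsD(5)[OF \<psi>, where S = UNIV]] continuous_intros) simp
      have int\<psi>: "integrable lebesgue (\<lambda>z. \<psi> (fst z) *\<^sub>R w z)" if "integrable lebesgue w" for w :: "'a \<times> 'b \<Rightarrow> 'c"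
        using that fst N by (rule integrable_bounded_scaleR)
      have \<psi>0: "indicat_real I t *\<^sub>R (\<psi> t *\<^sub>R y) = \<psi> t *\<^sub>R y" for t and y :: 'c
        using test_function_outside[OF \<psi>, of t] by (cases "t \<in> I") simp_all
      have "(LINT t:I|lebesgue. \<psi> t *\<^sub>R g t) = (LINT t|lebesgue. LINT x|lebesgue. \<psi> t *\<^sub>R (u' (t, x) + D' (t, x)))"
        unfolding set_lebesgue_integral_def \<psi>0 by (simp add: g_def)
      also have "\<dots> = (LINT z|lebesgue. \<psi> (fst z) *\<^sub>R (u' z + D' z))"
        using lebesgue_fubini(3)[OF int\<psi>[OF int]] by simp
      also have "\<dots> = (LINT z|lebesgue. \<psi> (fst z) *\<^sub>R u' z) + (LINT z|lebesgue. \<psi> (fst z) *\<^sub>R D' z)"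
        unfolding scaleR_add_right by (rule Bochner_Integration.integral_add[OF int\<psi>[OF u'] int\<psi>[OF D']])
      also have "(LINT z|lebesgue. \<psi> (fst z) *\<^sub>R u' z)
          = (LINT z:interior A|lebesgue. frechet_derivative ?p (at z) (0, b) *\<^sub>R u z)"
        unfolding set_lebesgue_integral_def tensor_test_function_derivative[OF \<psi> \<phi>] u'_def
        by (intro Bochner_Integration.integral_cong refl) (simp add: mult_ac)
      also have "(LINT z|lebesgue. \<psi> (fst z) *\<^sub>R D' z) = (LINT z:interior A|lebesgue. ?p z *\<^sub>R D (0, b) z)"
        unfolding set_lebesgue_integral_def D'_def
        by (intro Bochner_Integration.integral_cong refl) (simp add: mult_ac)
      also have "(LINT z:interior A|lebesgue. frechet_derivative ?p (at z) (0, b) *\<^sub>R u z)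
          = - (LINT z:interior A|lebesgue. ?p z *\<^sub>R D (0, b) z)"
      proof -
        have "(0, b) \<in> (Basis :: ('a \<times> 'b) set)" using b by (simp add: Basis_prod_def)
        then show ?thesis using wg p unfolding weak_gradient_def by blast
      qed
      finally show "(LINT t:I|lebesgue. \<psi> t *\<^sub>R g t) = 0" by simp
    qed
    then show ?thesis using slice[OF u] slice[OF D[OF b]]
    proof eventually_elim
      case (elim t)
      show ?case
      proof
        assume t: "t \<in> I"
        have 1: "set_integrable lebesgue ?V (\<lambda>x. frechet_derivative \<phi> (at x) b *\<^sub>R u (t, x))"
          using elim t by (intro set_integrable_bounded_scaleR[OF _ test_function_measurable(2)[OF \<phi> b] M]) simp
        have 2: "set_integrable lebesgue ?V (\<lambda>x. \<phi> x *\<^sub>R D (0, b) (t, x))"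
          using elim t by (intro set_integrable_bounded_scaleR[OF _ test_function_measurable(1)[OF \<phi>] M']) simp
        have "(LINT x:?V|lebesgue. frechet_derivative \<phi> (at x) b *\<^sub>R u (t, x) + \<phi> x *\<^sub>R D (0, b) (t, x)) = g t"
          unfolding set_lebesgue_integral_def g_def u'_def D'_def
          by (intro Bochner_Integration.integral_cong refl) (simp add: ind[OF t] scaleR_add_right mult_ac)
        then show "(LINT x:?V|lebesgue. frechet_derivative \<phi> (at x) b *\<^sub>R u (t, x)) = - (LINT x:?V|lebesgue. \<phi> x *\<^sub>R D (0, b) (t, x))"
          using elim t set_integral_add(2)[OF 1 2] by (simp add: eq_neg_iff_add_eq_0)
      qed
    qed
  qed
  show ?thesis
  proof (rule weak_gradient_countable_tests[of B])
    fix \<Phi> assume \<Phi>: "countable \<Phi>" "\<Phi> \<subseteq> test_functions ?V"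
      and suff: "\<And>(v :: 'b \<Rightarrow> 'c) E. set_integrable lebesgue ?V v \<Longrightarrow>
        (\<And>b. b \<in> Basis \<Longrightarrow> set_integrable lebesgue ?V (E b)) \<Longrightarrow>
        (\<And>b \<phi>. b \<in> Basis \<Longrightarrow> \<phi> \<in> \<Phi> \<Longrightarrow> (LINT x:?V|lebesgue. frechet_derivative \<phi> (at x) b *\<^sub>R v x) =
             - (LINT x:?V|lebesgue. \<phi> x *\<^sub>R E b x)) \<Longrightarrow> weak_gradient B v E"
    have "AE t in lebesgue. \<forall>p\<in>Basis \<times> \<Phi>. t \<in> I \<longrightarrow>
        (LINT x:?V|lebesgue. frechet_derivative (snd p) (at x) (fst p) *\<^sub>R u (t, x)) = - (LINT x:?V|lebesgue. snd p x *\<^sub>R D (0, fst p) (t, x))"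
      using \<Phi> id by (subst AE_ball_countable) (auto intro!: countable_SIGMA countable_finite[OF finite_Basis])
    moreover have "AE t in lebesgue. \<forall>b\<in>Basis. t \<in> I \<longrightarrow> set_integrable lebesgue ?V (\<lambda>x. D (0, b) (t, x))"
      using slice[OF D] by (intro AE_finite_allI) auto
    ultimately show ?thesis using slice[OF u]
    proof eventually_elim
      case (elim t)
      show ?case
      proof
        assume "t \<in> I"
        with elim show "weak_gradient B (\<lambda>x. u (t, x)) (\<lambda>b x. D (0, b) (t, x))"
          by (intro suff) auto
      qed
    qed
  qed
qed

section \<open>Pairing with the weak gradient\<close>

text \<open>Extension by zero: functions given on \<open>lebesgue_on A\<close> become square
  summable on the whole space, where all pairings are integrated.\<close>

lemma square_summable_indicator:
  assumes f: "square_summable A f" and A: "A \<in> sets lebesgue" and B: "B \<in> sets lebesgue" "B \<subseteq> A"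
  shows "square_summable UNIV (\<lambda>x. indicat_real B x *\<^sub>R f x)"
proof -
  have 1: "(\<lambda>x. indicat_real A x *\<^sub>R f x) \<in> borel_measurable lebesgue"
    using f A by (simp add: square_summable_def borel_measurable_restrict_space_iff)
  have 2: "integrable lebesgue (\<lambda>x. indicat_real A x *\<^sub>R (norm (f x))\<^sup>2)"
    using f A by (simp add: square_summable_def integrable_restrict_space)
  have "(\<lambda>x. indicat_real B x *\<^sub>R (indicat_real A x *\<^sub>R f x)) \<in> borel_measurable lebesgue"
    using borel_measurable_indicator[OF B(1)] 1 by (rule borel_measurable_scaleR)
  moreover have "integrable lebesgue (\<lambda>x. indicat_real B x *\<^sub>R (indicat_real A x *\<^sub>R (norm (f x))\<^sup>2))"
    using B(1) 2 by (rule integrable_mult_indicator)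
  moreover have "indicat_real B x *\<^sub>R (indicat_real A x *\<^sub>R f x) = indicat_real B x *\<^sub>R f x"
    "indicat_real B x *\<^sub>R (indicat_real A x *\<^sub>R (norm (f x))\<^sup>2) = (norm (indicat_real B x *\<^sub>R f x))\<^sup>2" for x
    using B(2) by (cases "x \<in> B"; auto)+
  ultimately show ?thesis unfolding square_summable_def by (simp only: lebesgue_on_UNIV_eq simp_thms)
qed

lemma square_summable_UNIV:
  "square_summable UNIV f \<longleftrightarrow> f \<in> borel_measurable lebesgue \<and> integrable lebesgue (\<lambda>x. (norm (f x))\<^sup>2)"
  by (simp add: square_summable_def lebesgue_on_UNIV_eq)

text \<open>Besides making products of square summable functions integrable, this supplies the one
  half of the final energy estimate.\<close>

lemma abs_inner_le_squares:
  fixes x y :: "'a::real_inner"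
  shows "\<bar>x \<bullet> y\<bar> \<le> ((norm x)\<^sup>2 + (norm y)\<^sup>2) / 2"
proof -
  have "\<bar>x \<bullet> y\<bar> \<le> norm x * norm y" by (rule Cauchy_Schwarz_ineq2)
  also have "\<dots> \<le> ((norm x)\<^sup>2 + (norm y)\<^sup>2) / 2"
    using sum_squares_bound[of "norm x" "norm y"] by simp
  finally show ?thesis .
qed

lemma norm_add_square_le:
  fixes x y :: "'a::real_inner"
  shows "(norm (x + y))\<^sup>2 \<le> 2 * (norm x)\<^sup>2 + 2 * (norm y)\<^sup>2"
  using abs_inner_le_squares[of x y]
  by (simp add: power2_norm_eq_inner inner_add_left inner_add_right inner_commute)

lemma integrable_inner_square_summable:
  fixes f g :: "'a::euclidean_space \<Rightarrow> 'b::euclidean_space"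
  assumes "square_summable UNIV f" "square_summable UNIV g"
  shows "integrable lebesgue (\<lambda>x. f x \<bullet> g x)"
proof (rule Bochner_Integration.integrable_bound)
  show "integrable lebesgue (\<lambda>x. ((norm (f x))\<^sup>2 + (norm (g x))\<^sup>2) / 2)"
    using assms by (simp add: square_summable_UNIV)
  show "(\<lambda>x. f x \<bullet> g x) \<in> borel_measurable lebesgue"
    using assms by (intro borel_measurable_inner) (simp_all add: square_summable_UNIV)
  show "AE x in lebesgue. norm (f x \<bullet> g x) \<le> norm (((norm (f x))\<^sup>2 + (norm (g x))\<^sup>2) / 2)"
    using abs_inner_le_squares[of "f _" "g _"] by (intro AE_I2) simp
qed

section \<open>Vector space operations on square summable functions and on \<open>Y2\<close>\<close>

lemma square_summable_add:
  fixes f g :: "'a::euclidean_space \<Rightarrow> 'b::euclidean_space"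
  assumes "square_summable A f" "square_summable A g"
  shows "square_summable A (\<lambda>x. f x + g x)"
proof -
  have m: "(\<lambda>x. f x + g x) \<in> borel_measurable (lebesgue_on A)"
    using assms by (auto simp: square_summable_def intro: borel_measurable_add)
  have "integrable (lebesgue_on A) (\<lambda>x. (norm (f x + g x))\<^sup>2)"
  proof (rule Bochner_Integration.integrable_bound)
    show "integrable (lebesgue_on A) (\<lambda>x. 2 * (norm (f x))\<^sup>2 + 2 * (norm (g x))\<^sup>2)"
      using assms by (auto simp: square_summable_def)
    show "(\<lambda>x. (norm (f x + g x))\<^sup>2) \<in> borel_measurable (lebesgue_on A)"
      using measurable_compose[OF m, of "\<lambda>y. (norm y)\<^sup>2" borel] by simp
  qed (simp add: norm_add_square_le)
  then show ?thesis using m by (simp add: square_summable_def)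
qed

lemma square_summable_scaleR:
  fixes f :: "'a::euclidean_space \<Rightarrow> 'b::euclidean_space"
  assumes "square_summable A f"
  shows "square_summable A (\<lambda>x. c *\<^sub>R f x)"
proof -
  have "(\<lambda>x. c *\<^sub>R f x) \<in> borel_measurable (lebesgue_on A)"
    using assms by (intro borel_measurable_scaleR borel_measurable_const) (simp add: square_summable_def)
  then show ?thesis using assms by (simp add: square_summable_def power_mult_distrib)
qed

lemma Y2_add: "u \<in> Y2 A \<Longrightarrow> v \<in> Y2 A \<Longrightarrow> (\<lambda>x. u x + v x) \<in> Y2 A"
proof -
  assume "u \<in> Y2 A" "v \<in> Y2 A"
  then obtain D D' where "square_summable A u" "square_summable A v"
    and D: "weak_gradient A u D" "\<forall>b\<in>Basis. square_summable A (D b)"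
    and D': "weak_gradient A v D'" "\<forall>b\<in>Basis. square_summable A (D' b)"
    by (auto simp: Y2_def)
  moreover have "\<forall>b\<in>Basis. square_summable A (\<lambda>x. D b x + D' b x)"
    using D(2) D'(2) square_summable_add by blast
  ultimately show ?thesis
    unfolding Y2_def using square_summable_add weak_gradient_add[OF D(1) D'(1)] by blast
qed

lemma Y2_scaleR: "u \<in> Y2 A \<Longrightarrow> (\<lambda>x. c *\<^sub>R u x) \<in> Y2 A"
proof -
  assume "u \<in> Y2 A"
  then obtain D where "square_summable A u"
    and D: "weak_gradient A u D" "\<forall>b\<in>Basis. square_summable A (D b)"
    by (auto simp: Y2_def)
  moreover have "\<forall>b\<in>Basis. square_summable A (\<lambda>x. c *\<^sub>R D b x)"
    using D(2) square_summable_scaleR by blast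
  ultimately show ?thesis
    unfolding Y2_def using square_summable_scaleR weak_gradient_scaleR[OF D(1), of c] by blast
qed

lemma dirichlet_integral_eq_integral:
  fixes u :: "'a::euclidean_space \<Rightarrow> 'b::euclidean_space"
  assumes A: "A \<in> sets lebesgue" "negligible (A - interior A)"
    and D: "weak_gradient A u D" "\<And>b. b \<in> Basis \<Longrightarrow> square_summable A (D b)"
  shows "dirichlet_integral A u
    = ennreal (LINT x|lebesgue. (\<Sum>b\<in>Basis. (norm (indicat_real (interior A) x *\<^sub>R D b x))\<^sup>2))"
proof -
  have "integrable lebesgue (\<lambda>x. (norm (indicat_real (interior A) x *\<^sub>R D b x))\<^sup>2)" if "b \<in> Basis" for b
    using square_summable_indicator[OF D(2)[OF that] A(1) _ interior_subset]
    unfolding square_summable_UNIV by simp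
  then have "integrable lebesgue (\<lambda>x. \<Sum>b\<in>Basis. (norm (indicat_real (interior A) x *\<^sub>R D b x))\<^sup>2)"
    by (intro Bochner_Integration.integrable_sum)
  then have "ennreal (LINT x|lebesgue. (\<Sum>b\<in>Basis. (norm (indicat_real (interior A) x *\<^sub>R D b x))\<^sup>2))
      = (\<integral>\<^sup>+x. ennreal (\<Sum>b\<in>Basis. (norm (indicat_real (interior A) x *\<^sub>R D b x))\<^sup>2) \<partial>lebesgue)"
    by (rule nn_integral_eq_integral[symmetric]) (intro AE_I2 sum_nonneg zero_le_power2)
  also have "\<dots> = dirichlet_integral A u"
    unfolding dirichlet_integral_eq[OF D(1) A]
    by (intro nn_integral_cong) (simp add: indicator_def)
  finally show ?thesis by simp
qed

section \<open>The Cauchy-Schwarz inequality for families of square summable functions\<close>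

lemma quadratic_nonneg_imp:
  fixes F P G :: real
  assumes "\<And>s. 0 \<le> s\<^sup>2 * F + 2 * s * P + G" "0 \<le> F"
  shows "P\<^sup>2 \<le> F * G"
proof (cases "F = 0")
  case True
  have "P = 0"
  proof (rule ccontr)
    assume "P \<noteq> 0"
    \<comment> \<open>At this \<open>s\<close> the expression equals -1.\<close>
    then show False using assms(1)[of "- (G + 1) / (2 * P)"] True by (simp add: field_simps)
  qed
  then show ?thesis using True by simp
next
  case False
  \<comment> \<open>\<open>- P / F\<close> is the minimizer of the quadratic polynomial in
    \<open>s\<close>.\<close>
  then show ?thesis using assms(1)[of "- P / F"] assms(2)
    by (simp add: field_simps power2_eq_square)
qed

text \<open>The integral of |s f + g|^2, summed over \<open>I\<close>, is a nonnegative quadratic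
  polynomial in \<open>s\<close>.\<close>

lemma Cauchy_Schwarz_square_summable:
  fixes f g :: "'i \<Rightarrow> 'a::euclidean_space \<Rightarrow> 'b::euclidean_space"
  assumes f: "\<And>b. b \<in> I \<Longrightarrow> square_summable UNIV (f b)" and g: "\<And>b. b \<in> I \<Longrightarrow> square_summable UNIV (g b)"
  shows "(LINT x|lebesgue. (\<Sum>b\<in>I. f b x \<bullet> g b x))\<^sup>2
    \<le> (LINT x|lebesgue. (\<Sum>b\<in>I. (norm (f b x))\<^sup>2)) * (LINT x|lebesgue. (\<Sum>b\<in>I. (norm (g b x))\<^sup>2))"
proof (rule quadratic_nonneg_imp)
  show "0 \<le> (LINT x|lebesgue. (\<Sum>b\<in>I. (norm (f b x))\<^sup>2))"
    by (intro integral_nonneg_AE AE_I2 sum_nonneg zero_le_power2)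
  fix s
  have if': "integrable lebesgue (\<lambda>x. \<Sum>b\<in>I. (norm (f b x))\<^sup>2)" and ig: "integrable lebesgue (\<lambda>x. \<Sum>b\<in>I. (norm (g b x))\<^sup>2)"
    and ifg: "integrable lebesgue (\<lambda>x. \<Sum>b\<in>I. f b x \<bullet> g b x)"
    using f g integrable_inner_square_summable
    by (auto intro!: Bochner_Integration.integrable_sum simp: square_summable_UNIV)
  have "0 \<le> (LINT x|lebesgue. (\<Sum>b\<in>I. (norm (s *\<^sub>R f b x + g b x))\<^sup>2))"
    by (intro integral_nonneg_AE AE_I2 sum_nonneg zero_le_power2)
  also have "(\<lambda>x. \<Sum>b\<in>I. (norm (s *\<^sub>R f b x + g b x))\<^sup>2)
      = (\<lambda>x. (s\<^sup>2 * (\<Sum>b\<in>I. (norm (f b x))\<^sup>2) + 2 * s * (\<Sum>b\<in>I. f b x \<bullet> g b x)) + (\<Sum>b\<in>I. (norm (g b x))\<^sup>2))"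
    unfolding sum_distrib_left sum.distrib[symmetric]
    by (intro ext sum.cong refl)
      (simp add: power2_norm_eq_inner inner_add_left inner_add_right inner_commute power2_eq_square[of s] algebra_simps)
  also have "(LINT x|lebesgue. (s\<^sup>2 * (\<Sum>b\<in>I. (norm (f b x))\<^sup>2) + 2 * s * (\<Sum>b\<in>I. f b x \<bullet> g b x)) + (\<Sum>b\<in>I. (norm (g b x))\<^sup>2))
     = s\<^sup>2 * (LINT x|lebesgue. (\<Sum>b\<in>I. (norm (f b x))\<^sup>2)) + 2 * s * (LINT x|lebesgue. (\<Sum>b\<in>I. f b x \<bullet> g b x))
      + (LINT x|lebesgue. (\<Sum>b\<in>I. (norm (g b x))\<^sup>2))"
    using if' ig ifg by (simp del: Bochner_Integration.integral_sum)
  finally show "0 \<le> s\<^sup>2 * (LINT x|lebesgue. (\<Sum>b\<in>I. (norm (f b x))\<^sup>2)) + 2 * s * (LINT x|lebesgue. (\<Sum>b\<in>I. f b x \<bullet> g b x))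
      + (LINT x|lebesgue. (\<Sum>b\<in>I. (norm (g b x))\<^sup>2))" .
qed

text \<open>A functional acts on functions, so writing one down in terms of gradients requires a
  fixed representative. Unlike the choice inside \<open>dirichlet_integral\<close>, this one is
  square summable for every member of \<open>Y2 A\<close>; both agree almost everywhere on the
  interior.\<close>

definition weak_grad :: "'a::euclidean_space set \<Rightarrow> ('a \<Rightarrow> 'b::euclidean_space) \<Rightarrow> 'a \<Rightarrow> 'a \<Rightarrow> 'b" where
  "weak_grad A u = (SOME D. weak_gradient A u D \<and> (\<forall>b\<in>Basis. square_summable A (D b)))"

lemma weak_grad:
  assumes "u \<in> Y2 A"
  shows "weak_gradient A u (weak_grad A u)" "b \<in> Basis \<Longrightarrow> square_summable A (weak_grad A u b)"
proof -
  have "\<exists>D. weak_gradient A u D \<and> (\<forall>b\<in>Basis. square_summable A (D b))" using assms by (simp add: Y2_def)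
  from someI_ex[OF this] show "weak_gradient A u (weak_grad A u)" "b \<in> Basis \<Longrightarrow> square_summable A (weak_grad A u b)"
    by (simp_all add: weak_grad_def)
qed

text \<open>Linearity survives the choice in \<open>weak_grad\<close>, because the gradient of a sum
  or a multiple is determined almost everywhere on the interior, to which the indicator restricts.
  \<open>Bs\<close> may be a proper part of the basis, so that spatial directions can be paired
  alone.\<close>

lemma bounded_functional_gradient_pairing:
  fixes g :: "'a::euclidean_space \<Rightarrow> 'a \<Rightarrow> 'b::euclidean_space"
  assumes A: "A \<in> sets lebesgue" "negligible (A - interior A)"
    and Bs: "Bs \<subseteq> Basis" and g: "\<And>b. b \<in> Bs \<Longrightarrow> square_summable UNIV (g b)"
  shows "bounded_functional A
    (\<lambda>w. LINT x|lebesgue. (\<Sum>b\<in>Bs. (indicat_real (interior A) x *\<^sub>R weak_grad A w b x) \<bullet> g b x))"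
    (is "bounded_functional A ?\<Lambda>")
proof -
  let ?i = "indicat_real (interior A)"
  have sq: "square_summable UNIV (\<lambda>x. ?i x *\<^sub>R weak_grad A w b x)" if "w \<in> Y2 A" "b \<in> Basis" for w :: "'a \<Rightarrow> 'b" and b
    using weak_grad(2)[OF that] A(1) by (rule square_summable_indicator) (auto simp: interior_subset)
  have int: "integrable lebesgue (\<lambda>x. \<Sum>b\<in>Bs. (?i x *\<^sub>R weak_grad A w b x) \<bullet> g b x)" if "w \<in> Y2 A" for w :: "'a \<Rightarrow> 'b"
    using sq[OF that] g Bs by (intro Bochner_Integration.integrable_sum integrable_inner_square_summable) auto
  have unique: "AE x in lebesgue. (\<Sum>b\<in>Bs. (?i x *\<^sub>R weak_grad A w b x) \<bullet> g b x) = (\<Sum>b\<in>Bs. (?i x *\<^sub>R D b x) \<bullet> g b x)"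
    if "w \<in> Y2 A" "weak_gradient A w D" for w :: "'a \<Rightarrow> 'b" and D
  proof -
    have "AE x in lebesgue. \<forall>b\<in>Basis. x \<in> interior A \<longrightarrow> weak_grad A w b x = D b x"
      using weak_gradient_unique[OF weak_grad(1)[OF that(1)] that(2)] by (intro AE_finite_allI) auto
    then show ?thesis
      by eventually_elim (intro sum.cong refl, use Bs in \<open>auto simp: indicator_def\<close>)
  qed
  have "?\<Lambda> (\<lambda>x. u x + v x) = ?\<Lambda> u + ?\<Lambda> v" if u: "u \<in> Y2 A" and v: "v \<in> Y2 A" for u v
  proof -
    have "?\<Lambda> (\<lambda>x. u x + v x) = (LINT x|lebesgue. (\<Sum>b\<in>Bs. (?i x *\<^sub>R weak_grad A u b x) \<bullet> g b x)
        + (\<Sum>b\<in>Bs. (?i x *\<^sub>R weak_grad A v b x) \<bullet> g b x))"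
    proof (rule integral_cong_AE)
      show "AE x in lebesgue. (\<Sum>b\<in>Bs. (?i x *\<^sub>R weak_grad A (\<lambda>x. u x + v x) b x) \<bullet> g b x)
          = (\<Sum>b\<in>Bs. (?i x *\<^sub>R weak_grad A u b x) \<bullet> g b x) + (\<Sum>b\<in>Bs. (?i x *\<^sub>R weak_grad A v b x) \<bullet> g b x)"
        using unique[OF Y2_add[OF u v] weak_gradient_add[OF weak_grad(1)[OF u] weak_grad(1)[OF v]]]
        by (simp add: sum.distrib[symmetric] scaleR_add_right inner_add_left)
    qed (use int[OF Y2_add[OF u v]] int[OF u] int[OF v] in \<open>auto simp del: Bochner_Integration.integrable_sum\<close>)
    then show ?thesis using int[OF u] int[OF v] by (simp del: Bochner_Integration.integral_sum)
  qed
  moreover have "?\<Lambda> (\<lambda>x. c *\<^sub>R u x) = c * ?\<Lambda> u" if u: "u \<in> Y2 A" for c u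
  proof -
    have "?\<Lambda> (\<lambda>x. c *\<^sub>R u x) = (LINT x|lebesgue. c * (\<Sum>b\<in>Bs. (?i x *\<^sub>R weak_grad A u b x) \<bullet> g b x))"
    proof (rule integral_cong_AE)
      show "AE x in lebesgue. (\<Sum>b\<in>Bs. (?i x *\<^sub>R weak_grad A (\<lambda>x. c *\<^sub>R u x) b x) \<bullet> g b x)
          = c * (\<Sum>b\<in>Bs. (?i x *\<^sub>R weak_grad A u b x) \<bullet> g b x)"
        using unique[OF Y2_scaleR[OF u] weak_gradient_scaleR[OF weak_grad(1)[OF u]], of c]
        by (simp add: sum_distrib_left mult_ac)
    qed (use int[OF Y2_scaleR[OF u]] int[OF u] in \<open>auto simp del: Bochner_Integration.integrable_sum\<close>)
    then show ?thesis by simp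
  qed
  moreover have "\<bar>?\<Lambda> w\<bar> \<le> sqrt (LINT x|lebesgue. (\<Sum>b\<in>Bs. (norm (g b x))\<^sup>2)) * sobolev_norm A w"
    if w: "w \<in> Y2 A" for w
  proof -
    let ?G = "LINT x|lebesgue. (\<Sum>b\<in>Bs. (norm (g b x))\<^sup>2)"
    let ?F = "\<lambda>I. LINT x|lebesgue. (\<Sum>b\<in>I. (norm (?i x *\<^sub>R weak_grad A w b x))\<^sup>2)"
    have Fint: "integrable lebesgue (\<lambda>x. \<Sum>b\<in>I. (norm (?i x *\<^sub>R weak_grad A w b x))\<^sup>2)" if "I \<subseteq> Basis" for I
      using sq[OF w] that unfolding square_summable_UNIV by (intro Bochner_Integration.integrable_sum) blast
    have G0: "0 \<le> ?G" by (intro integral_nonneg_AE AE_I2 sum_nonneg zero_le_power2)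
    have "(?\<Lambda> w)\<^sup>2 \<le> ?F Bs * ?G"
      using sq[OF w] g Bs by (intro Cauchy_Schwarz_square_summable) auto
    also have "?F Bs \<le> ?F Basis"
      using Bs by (intro integral_mono_AE Fint AE_I2 sum_mono2) auto
    finally have 1: "(?\<Lambda> w)\<^sup>2 \<le> ?F Basis * ?G" using G0 by (simp add: mult_right_mono)
    have "integrable (lebesgue_on A) (\<lambda>x. (norm (w x))\<^sup>2)"
      using w by (simp add: Y2_def square_summable_def)
    then have l2: "l2_norm_sq A w < \<infinity>"
      unfolding l2_norm_sq_def by (subst nn_integral_eq_integral) auto
    have dir: "dirichlet_integral A w = ennreal (?F Basis)"
      by (rule dirichlet_integral_eq_integral[OF A weak_grad[OF w]])
    have F0: "0 \<le> ?F Basis" by (intro integral_nonneg_AE AE_I2 sum_nonneg zero_le_power2)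
    have "?F Basis = enn2real (dirichlet_integral A w)" unfolding dir using F0 by simp
    \<comment> \<open>\<open>enn2real\<close> sends infinity to 0, so monotonicity depends on the
      sum being finite.\<close>
    also have "\<dots> \<le> enn2real (l2_norm_sq A w + dirichlet_integral A w)"
      using l2 by (intro enn2real_mono) (auto simp: dir)
    finally have "?F Basis * ?G \<le> enn2real (l2_norm_sq A w + dirichlet_integral A w) * ?G"
      using G0 by (rule mult_right_mono)
    with 1 have "sqrt ((?\<Lambda> w)\<^sup>2) \<le> sqrt (enn2real (l2_norm_sq A w + dirichlet_integral A w) * ?G)"
      by (intro real_sqrt_le_mono) linarith
    then show ?thesis by (simp add: sobolev_norm_def real_sqrt_mult mult.commute)
  qed
  ultimately show ?thesis unfolding bounded_functional_def by blast
qed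

section \<open>Energy of the slices of a weak limit\<close>

text \<open>On a set of finite measure, |y| \<le> |y|^2 + 1 makes square summable functions
  summable. Slicing relies on this, since Fubini and the countable tests work with integrability on
  the whole interior.\<close>

lemma square_summable_set_integrable:
  fixes f :: "'a::euclidean_space \<Rightarrow> 'b::euclidean_space"
  assumes f: "square_summable A f" and A: "A \<in> lmeasurable"
  shows "set_integrable lebesgue (interior A) f"
  unfolding set_integrable_def
proof (rule Bochner_Integration.integrable_bound)
  have sq: "square_summable UNIV (\<lambda>x. indicat_real (interior A) x *\<^sub>R f x)"
    using f fmeasurableD[OF A] by (rule square_summable_indicator) (auto simp: interior_subset)
  have "integrable lebesgue (indicat_real A)"
    using A by (intro integrable_real_indicator) (simp_all add: fmeasurable_def del: emeasure_completion)
  then show "integrable lebesgue (\<lambda>x. (norm (indicat_real (interior A) x *\<^sub>R f x))\<^sup>2 + indicat_real A x)"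
    using sq unfolding square_summable_UNIV by (intro Bochner_Integration.integrable_add) auto
  show "(\<lambda>x. indicat_real (interior A) x *\<^sub>R f x) \<in> borel_measurable lebesgue"
    using sq by (simp add: square_summable_UNIV)
  have "norm y \<le> (norm y)\<^sup>2 + 1" for y :: 'b
    using sum_squares_bound[of "norm y" 1] norm_ge_zero[of y] unfolding mult_1_right one_power2 by linarith
  then show "AE x in lebesgue. norm (indicat_real (interior A) x *\<^sub>R f x)
      \<le> norm ((norm (indicat_real (interior A) x *\<^sub>R f x))\<^sup>2 + indicat_real A x)"
    using interior_subset[of A] by (intro AE_I2) (auto simp: indicator_def)
qed

text \<open>The energy density in the directions \<open>(0, b)\<close> only; when the first factor
  is time, this is the spatial part.\<close>

definition slice_density :: "('a::euclidean_space \<times> 'b::euclidean_space) set \<Rightarrow>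
    ('a \<times> 'b \<Rightarrow> 'c::euclidean_space) \<Rightarrow> 'a \<times> 'b \<Rightarrow> real" where
  "slice_density A w z = (\<Sum>b\<in>Basis. (norm (indicat_real (interior A) z *\<^sub>R weak_grad A w (0, b) z))\<^sup>2)"

lemma slice_density_nonneg: "0 \<le> slice_density A w z"
  by (simp add: slice_density_def sum_nonneg)

text \<open>Comes from a single gradient on the product and is therefore measurable in
  \<open>t\<close>, while \<open>dirichlet_integral\<close> of the slices rests on a separate choice
  for each \<open>t\<close>.\<close>

definition slice_energy :: "('a::euclidean_space \<times> 'b::euclidean_space) set \<Rightarrow>
    ('a \<times> 'b \<Rightarrow> 'c::euclidean_space) \<Rightarrow> 'a \<Rightarrow> ennreal" where
  "slice_energy A w t = (\<integral>\<^sup>+x. ennreal (slice_density A w (t, x)) \<partial>lebesgue)"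

lemma Pair_0_Basis: "b \<in> Basis \<Longrightarrow> (0, b) \<in> Basis"
  by (simp add: Basis_prod_def)

lemma square_summable_weak_grad:
  assumes "w \<in> Y2 A" "b \<in> Basis" "A \<in> sets lebesgue"
  shows "square_summable UNIV (\<lambda>x. indicat_real (interior A) x *\<^sub>R weak_grad A w b x)"
  using weak_grad(2)[OF assms(1,2)] assms(3) by (rule square_summable_indicator) (auto simp: interior_subset)

lemma integrable_slice_density:
  assumes "w \<in> Y2 A" "A \<in> sets lebesgue"
  shows "integrable lebesgue (slice_density A w)"
  unfolding slice_density_def
  using square_summable_weak_grad[OF assms(1) Pair_0_Basis assms(2)]
  by (intro Bochner_Integration.integrable_sum) (simp add: square_summable_UNIV)

lemma slice_energy_measurable:
  assumes "w \<in> Y2 A" "A \<in> sets lebesgue"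
  shows "slice_energy A w \<in> borel_measurable lebesgue"
  unfolding slice_energy_def[abs_def]
  using borel_measurable_integrable[OF integrable_slice_density[OF assms]]
  by (intro lebesgue_tonelli(1)) simp

lemma fst_indicator_measurable:
  assumes "S \<in> sets borel"
  shows "(\<lambda>z :: 'a::euclidean_space \<times> 'b::euclidean_space. indicat_real S (fst z)) \<in> borel_measurable lebesgue"
proof (rule measurable_completion)
  have "fst \<in> borel_measurable (borel :: ('a \<times> 'b) measure)"
    by (intro borel_measurable_continuous_onI continuous_intros)
  then have "(\<lambda>z :: 'a \<times> 'b. indicat_real S (fst z)) \<in> borel_measurable borel"
    using assms by (rule measurable_compose[OF _ borel_measurable_indicator])
  then show "(\<lambda>z :: 'a \<times> 'b. indicat_real S (fst z)) \<in> borel_measurable lborel" by simp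
qed

text \<open>Tonelli over the cylinder above \<open>S\<close>. The energy there is a finite real
  number, which later permits moving it from one side of an inequality to the other.\<close>

lemma integral_slice_density:
  assumes w: "w \<in> Y2 A" and A: "A \<in> sets lebesgue" and S: "S \<in> sets borel"
  shows "integrable lebesgue (\<lambda>z. indicat_real S (fst z) * slice_density A w z)"
    and "ennreal (LINT z|lebesgue. indicat_real S (fst z) * slice_density A w z)
      = (\<integral>\<^sup>+t. slice_energy A w t * indicator S t \<partial>lebesgue)"
proof -
  show int: "integrable lebesgue (\<lambda>z. indicat_real S (fst z) * slice_density A w z)"
    using integrable_bounded_scaleR[OF integrable_slice_density[OF w A] fst_indicator_measurable[OF S], of 1]
    by (simp add: indicator_def)
  have "ennreal (LINT z|lebesgue. indicat_real S (fst z) * slice_density A w z)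
      = (\<integral>\<^sup>+z. ennreal (indicat_real S (fst z) * slice_density A w z) \<partial>lebesgue)"
    by (rule nn_integral_eq_integral[OF int, symmetric]) (simp add: slice_density_nonneg)
  also have "\<dots> = (\<integral>\<^sup>+t. \<integral>\<^sup>+x. ennreal (indicat_real S t * slice_density A w (t, x)) \<partial>lebesgue \<partial>lebesgue)"
    using lebesgue_tonelli(2)[of "\<lambda>z. ennreal (indicat_real S (fst z) * slice_density A w z)"]
      borel_measurable_integrable[OF int] by simp
  also have "\<dots> = (\<integral>\<^sup>+t. slice_energy A w t * indicator S t \<partial>lebesgue)"
    by (intro nn_integral_cong) (simp add: slice_energy_def indicator_def)
  finally show "ennreal (LINT z|lebesgue. indicat_real S (fst z) * slice_density A w z)
      = (\<integral>\<^sup>+t. slice_energy A w t * indicator S t \<partial>lebesgue)" .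
qed

text \<open>The sliced gradient is a weak gradient of almost every slice, and the Dirichlet integral
  may be computed from any weak gradient.\<close>

lemma slice_energy_eq_dirichlet_integral:
  assumes w: "w \<in> Y2 A" and A: "A \<in> lmeasurable" "interior A = I \<times> interior B" "open I"
    and B: "B \<in> sets lebesgue" "negligible (B - interior B)"
  shows "AE t in lebesgue. t \<in> I \<longrightarrow> slice_energy A w t = dirichlet_integral B (\<lambda>x. w (t, x))"
proof -
  have "square_summable A w" using w by (simp add: Y2_def)
  then have "AE t in lebesgue. t \<in> I \<longrightarrow> weak_gradient B (\<lambda>x. w (t, x)) (\<lambda>b x. weak_grad A w (0, b) (t, x))"
    using weak_grad(2)[OF w Pair_0_Basis]
    by (intro weak_gradient_slice[OF weak_grad(1)[OF w] A(2,3)] square_summable_set_integrable[OF _ A(1)])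
  then show ?thesis
  proof eventually_elim
    case (elim t)
    show ?case
    proof
      assume t: "t \<in> I"
      then have "dirichlet_integral B (\<lambda>x. w (t, x))
        = (\<integral>\<^sup>+x. ennreal (\<Sum>b\<in>Basis. (norm (weak_grad A w (0, b) (t, x)))\<^sup>2) * indicator (interior B) x \<partial>lebesgue)"
        using elim dirichlet_integral_eq[OF _ B] by blast
      also have "\<dots> = slice_energy A w t"
        unfolding slice_energy_def slice_density_def using t A(2)
        by (intro nn_integral_cong) (simp add: indicator_def)
      finally show "slice_energy A w t = dirichlet_integral B (\<lambda>x. w (t, x))" by simp
    qed
  qed
qed

text \<open>The second factor of the pairing is fixed and square summable, so the pairing is a
  bounded functional of the first. At \<open>u\<close> it pairs the spatial gradient with itself and
  returns the energy above \<open>S\<close>.\<close>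

lemma weak_convergence_slice_pairing:
  assumes conv: "weakly_converges A U u" and A: "A \<in> sets lebesgue" "negligible (A - interior A)" and S: "S \<in> sets borel"
  shows "(\<lambda>k. LINT z|lebesgue. (\<Sum>b\<in>Basis. (indicat_real (interior A) z *\<^sub>R weak_grad A (U k) (0, b) z) \<bullet>
      (indicat_real S (fst z) *\<^sub>R (indicat_real (interior A) z *\<^sub>R weak_grad A u (0, b) z))))
    \<longlonglongrightarrow> (LINT z|lebesgue. indicat_real S (fst z) * slice_density A u z)"
proof -
  let ?i = "indicat_real (interior A)"
  let ?g = "\<lambda>b z. indicat_real S (fst z) *\<^sub>R (?i z *\<^sub>R weak_grad A u b z)"
  have u: "u \<in> Y2 A" using conv by (simp add: weakly_converges_def)
  have g: "square_summable UNIV (?g b)" if "b \<in> Pair 0 ` Basis" for b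
  proof -
    have b: "b \<in> Basis" using that Pair_0_Basis by auto
    note sq = square_summable_weak_grad[OF u b A(1), unfolded square_summable_UNIV]
    have 1: "?g b \<in> borel_measurable lebesgue"
      by (rule borel_measurable_scaleR[OF fst_indicator_measurable[OF S] conjunct1[OF sq]])
    have "integrable lebesgue (\<lambda>z. indicat_real S (fst z) *\<^sub>R (norm (?i z *\<^sub>R weak_grad A u b z))\<^sup>2)"
      by (rule integrable_bounded_scaleR[OF conjunct2[OF sq] fst_indicator_measurable[OF S], of 1]) (simp add: indicator_def)
    also have "(\<lambda>z. indicat_real S (fst z) *\<^sub>R (norm (?i z *\<^sub>R weak_grad A u b z))\<^sup>2) = (\<lambda>z. (norm (?g b z))\<^sup>2)"
      by (auto simp: indicator_def)
    finally show ?thesis using 1 unfolding square_summable_UNIV by simp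
  qed
  have inj: "inj_on (Pair 0) Basis" by (simp add: inj_on_def)
  have "Pair 0 ` Basis \<subseteq> Basis" using Pair_0_Basis by auto
  note bf = bounded_functional_gradient_pairing[OF A this g]
  have lim: "(\<lambda>k. \<Lambda> (U k)) \<longlonglongrightarrow> \<Lambda> u" if "bounded_functional A \<Lambda>" for \<Lambda>
    using conv that by (simp add: weakly_converges_def)
  have "(\<lambda>k. LINT z|lebesgue. (\<Sum>b\<in>Pair 0 ` Basis. (?i z *\<^sub>R weak_grad A (U k) b z) \<bullet> ?g b z))
      \<longlonglongrightarrow> (LINT z|lebesgue. (\<Sum>b\<in>Pair 0 ` Basis. (?i z *\<^sub>R weak_grad A u b z) \<bullet> ?g b z))"
    by (rule lim[OF bf])
  moreover have "(\<Sum>b\<in>Pair 0 ` Basis. (?i z *\<^sub>R weak_grad A u b z) \<bullet> ?g b z) = indicat_real S (fst z) * slice_density A u z" for z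
    unfolding sum.reindex[OF inj] slice_density_def sum_distrib_left
    by (intro sum.cong refl) (simp only: inner_scaleR_right power2_norm_eq_inner comp_apply)
  ultimately show ?thesis by (simp add: sum.reindex[OF inj])
qed

text \<open>The hypothesis bounds slices from a threshold on that depends on \<open>t\<close>,
  whereas weak convergence needs one threshold for a whole set of times. The violating times are
  therefore sorted by threshold. Finiteness of \<open>c\<close> and of the measure of
  \<open>I\<close> keeps the integrals comparable as real numbers.\<close>

theorem weak_limit_slice_energy_le:
  fixes U :: "nat \<Rightarrow> 'a::euclidean_space \<times> 'b::euclidean_space \<Rightarrow> 'c::euclidean_space"
  assumes conv: "weakly_converges A U u"
    and A: "A \<in> lmeasurable" "negligible (A - interior A)" "interior A = I \<times> interior B"
    and I: "open I" "I \<in> lmeasurable"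
    and B: "B \<in> sets lebesgue" "negligible (B - interior B)"
    and c: "c < \<infinity>"
    and le: "AE t in lebesgue. t \<in> I \<longrightarrow> (\<forall>\<^sub>F k in sequentially. dirichlet_integral B (\<lambda>x. U k (t, x)) \<le> c)"
  shows "AE t in lebesgue. t \<in> I \<longrightarrow> dirichlet_integral B (\<lambda>x. u (t, x)) \<le> c"
proof -
  have As: "A \<in> sets lebesgue" using A(1) by (rule fmeasurableD)
  have Y: "u \<in> Y2 A" "\<And>k. U k \<in> Y2 A" using conv by (auto simp: weakly_converges_def)
  \<comment> \<open>The times that violate the claim although \<open>N\<close> is a valid threshold
    for them. The use of \<open>slice_energy\<close> makes this set measurable.\<close>
  define G where "G N = {t \<in> I. (\<forall>k\<ge>N. slice_energy A (U k) t \<le> c) \<and> c < slice_energy A u t}" for N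
  have G: "AE t in lebesgue. t \<notin> G N" for N
  proof -
    have gt: "{t \<in> space lebesgue. c < slice_energy A w t} \<in> sets lebesgue" if "w \<in> Y2 A" for w :: "'a \<times> 'b \<Rightarrow> 'c"
      by (rule borel_measurable_less[OF borel_measurable_const slice_energy_measurable[OF that As]])
    have "G N = I \<inter> {t \<in> space lebesgue. c < slice_energy A u t} - (\<Union>k\<in>{N..}. {t \<in> space lebesgue. c < slice_energy A (U k) t})"
      by (auto simp: G_def not_less)
    also have "\<dots> \<in> sets lebesgue"
      by (intro sets.Diff sets.Int fmeasurableD[OF I(2)] gt Y sets.countable_UN') (use gt[OF Y(2)] in auto)
    finally have "G N \<in> sets lebesgue" .
    \<comment> \<open>\<open>G N\<close> is replaced by a Borel set up to a null set, because the
      indicator of \<open>S\<close> is composed with \<open>fst\<close> below.\<close>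
    then obtain S M M' where S1: "G N = S \<union> M" and M: "M \<subseteq> M'" "M' \<in> null_sets lborel" and S2: "S \<in> sets lborel"
      by (rule sets_completionE)
    note S = S1 S2
    have "AE t in lebesgue. t \<notin> M'" using M(2) by (intro AE_completion AE_not_in)
    moreover have "AE t in lebesgue. t \<notin> S"
    proof (rule ccontr)
      assume nS: "\<not> (AE t in lebesgue. t \<notin> S)"
      have Sb: "S \<in> sets borel" using S(2) by simp
      have Sl: "S \<in> sets lebesgue" using Sb by simp
      have SI: "S \<subseteq> I" and Sk: "\<And>t k. t \<in> S \<Longrightarrow> N \<le> k \<Longrightarrow> slice_energy A (U k) t \<le> c"
        and Su: "\<And>t. t \<in> S \<Longrightarrow> c < slice_energy A u t"
        using S(1) by (auto simp: G_def)
      have Sm: "emeasure lebesgue S < \<infinity>"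
        using emeasure_mono[OF SI] I(2) by (auto simp: fmeasurable_def simp del: emeasure_completion intro: le_less_trans)
      define K where "K = enn2real (c * emeasure lebesgue S)"
      have K: "ennreal K = c * emeasure lebesgue S"
        unfolding K_def using c Sm by (simp add: ennreal_mult_less_top del: emeasure_completion)
      define R where "R w = (LINT z|lebesgue. indicat_real S (fst z) * slice_density A w z)"
        for w :: "'a \<times> 'b \<Rightarrow> 'c"
      have R: "ennreal (R w) = (\<integral>\<^sup>+t. slice_energy A w t * indicator S t \<partial>lebesgue)" if "w \<in> Y2 A" for w
        unfolding R_def by (rule integral_slice_density(2)[OF that As Sb])
      have cS: "(\<integral>\<^sup>+t. c * indicator S t \<partial>lebesgue) = ennreal K"
        unfolding K using Sl by (rule nn_integral_cmult_indicator)
      have Rk: "R (U k) \<le> K" if "N \<le> k" for k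
      proof -
        have "ennreal (R (U k)) \<le> ennreal K"
          unfolding R[OF Y(2)] cS[symmetric]
          using Sk[OF _ that] by (intro nn_integral_mono) (auto simp: indicator_def)
        then show ?thesis by (simp add: K_def ennreal_le_iff)
      qed
      let ?W = "\<lambda>w b z. indicat_real (interior A) z *\<^sub>R weak_grad A w (0, b) z"
      have "(LINT z|lebesgue. (\<Sum>b\<in>Basis. ?W (U k) b z \<bullet> (indicat_real S (fst z) *\<^sub>R ?W u b z))) \<le> (R (U k) + R u) / 2" for k
      proof -
        have "(LINT z|lebesgue. (\<Sum>b\<in>Basis. ?W (U k) b z \<bullet> (indicat_real S (fst z) *\<^sub>R ?W u b z)))
          \<le> (LINT z|lebesgue. (indicat_real S (fst z) * slice_density A (U k) z + indicat_real S (fst z) * slice_density A u z) / 2)"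
        proof (rule integral_mono_AE)
          show "AE z in lebesgue. (\<Sum>b\<in>Basis. ?W (U k) b z \<bullet> (indicat_real S (fst z) *\<^sub>R ?W u b z))
              \<le> (indicat_real S (fst z) * slice_density A (U k) z + indicat_real S (fst z) * slice_density A u z) / 2"
          proof (rule AE_I2)
            fix z :: "'a \<times> 'b"
            have "(\<Sum>b\<in>Basis. ?W (U k) b z \<bullet> ?W u b z) \<le> (\<Sum>b\<in>Basis. ((norm (?W (U k) b z))\<^sup>2 + (norm (?W u b z))\<^sup>2) / 2)"
              by (intro sum_mono order_trans[OF abs_ge_self abs_inner_le_squares])
            also have "\<dots> = (slice_density A (U k) z + slice_density A u z) / 2"
              by (simp add: slice_density_def sum.distrib sum_divide_distrib[symmetric])
            finally show "(\<Sum>b\<in>Basis. ?W (U k) b z \<bullet> (indicat_real S (fst z) *\<^sub>R ?W u b z))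
              \<le> (indicat_real S (fst z) * slice_density A (U k) z + indicat_real S (fst z) * slice_density A u z) / 2"
              by (cases "fst z \<in> S") simp_all
          qed
          show "integrable lebesgue (\<lambda>z. (indicat_real S (fst z) * slice_density A (U k) z + indicat_real S (fst z) * slice_density A u z) / 2)"
            using integral_slice_density(1)[OF Y(2) As Sb] integral_slice_density(1)[OF Y(1) As Sb]
            by (intro integrable_divide_zero impI Bochner_Integration.integrable_add)
          have "integrable lebesgue (\<lambda>z. indicat_real S (fst z) *\<^sub>R (\<Sum>b\<in>Basis. ?W (U k) b z \<bullet> ?W u b z))"
          proof (rule integrable_bounded_scaleR[OF _ fst_indicator_measurable[OF Sb]])
            show "integrable lebesgue (\<lambda>z. \<Sum>b\<in>Basis. ?W (U k) b z \<bullet> ?W u b z)"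
              by (intro Bochner_Integration.integrable_sum integrable_inner_square_summable
                  square_summable_weak_grad Pair_0_Basis Y As)
            show "\<bar>indicat_real S (fst z)\<bar> \<le> 1" for z by simp
          qed
          then show "integrable lebesgue (\<lambda>z. \<Sum>b\<in>Basis. ?W (U k) b z \<bullet> (indicat_real S (fst z) *\<^sub>R ?W u b z))"
            by (simp only: inner_scaleR_right real_scaleR_def sum_distrib_left)
        qed
        also have "\<dots> = (R (U k) + R u) / 2"
          unfolding R_def using integral_slice_density(1)[OF Y(2) As Sb] integral_slice_density(1)[OF Y(1) As Sb] by simp
        finally show ?thesis .
      qed
      \<comment> \<open>The bound holds for \<open>k \<ge> N\<close>. In the limit the pairing
        becomes \<open>R u\<close>, which then stands on both sides; as a real number, half of it
        can be absorbed.\<close>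
      then have "R u \<le> (K + R u) / 2"
        using Rk by (intro LIMSEQ_le_const2[OF weak_convergence_slice_pairing[OF conv As A(2) Sb], folded R_def])
          (meson add_right_mono divide_right_mono order_trans zero_le_numeral)
      then have "R u \<le> K" by simp
      then have le: "(\<integral>\<^sup>+t. slice_energy A u t * indicator S t \<partial>lebesgue) \<le> (\<integral>\<^sup>+t. c * indicator S t \<partial>lebesgue)"
        unfolding R[OF Y(1), symmetric] cS by (rule ennreal_leI)
      \<comment> \<open>The integrands differ strictly on \<open>S\<close>, which is assumed not to
        be null, so the integrals differ strictly as well.\<close>
      have "(\<integral>\<^sup>+t. c * indicator S t \<partial>lebesgue) < (\<integral>\<^sup>+t. slice_energy A u t * indicator S t \<partial>lebesgue)"
      proof (rule nn_integral_less)
        show "(\<lambda>t. c * indicator S t) \<in> borel_measurable lebesgue"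
          by (intro borel_measurable_times_ennreal borel_measurable_const borel_measurable_indicator[OF Sl])
        show "(\<lambda>t. slice_energy A u t * indicator S t) \<in> borel_measurable lebesgue"
          by (intro borel_measurable_times_ennreal borel_measurable_indicator[OF Sl] slice_energy_measurable[OF Y(1) As])
        show "(\<integral>\<^sup>+t. c * indicator S t \<partial>lebesgue) \<noteq> \<infinity>" unfolding cS by simp
        show "AE t in lebesgue. c * indicator S t \<le> slice_energy A u t * indicator S t"
          using Su by (intro AE_I2) (auto simp: indicator_def intro: less_imp_le)
        show "\<not> (AE t in lebesgue. slice_energy A u t * indicator S t \<le> c * indicator S t)"
        proof
          assume "AE t in lebesgue. slice_energy A u t * indicator S t \<le> c * indicator S t"
          then have "AE t in lebesgue. t \<notin> S"
          proof eventually_elim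
            case (elim t)
            show "t \<notin> S"
            proof
              assume tS: "t \<in> S"
              then have "slice_energy A u t \<le> c" using elim by simp
              then show False using Su[OF tS] by (simp add: leD)
            qed
          qed
          then show False using nS by contradiction
        qed
      qed
      then show False using le by simp
    qed
    ultimately show ?thesis by eventually_elim (use S(1) M(1) in auto)
  qed
  have "AE t in lebesgue. \<forall>N. t \<notin> G N" using G by (simp add: AE_all_countable)
  moreover have "AE t in lebesgue. \<forall>k. t \<in> I \<longrightarrow> slice_energy A (U k) t = dirichlet_integral B (\<lambda>x. U k (t, x))"
    unfolding AE_all_countable by (rule allI) (rule slice_energy_eq_dirichlet_integral[OF Y(2) A(1,3) I(1) B])
  moreover note slice_energy_eq_dirichlet_integral[OF Y(1) A(1,3) I(1) B] le
  ultimately show ?thesis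
  proof eventually_elim
    case (elim t)
    show ?case
    proof
      assume t: "t \<in> I"
      then obtain N where "\<And>k. N \<le> k \<Longrightarrow> dirichlet_integral B (\<lambda>x. U k (t, x)) \<le> c"
        using elim(4) by (auto simp: eventually_sequentially)
      then show "dirichlet_integral B (\<lambda>x. u (t, x)) \<le> c"
        using elim(1-3) t by (auto simp: G_def not_less)
    qed
  qed
qed

section \<open>The step minimizing sequence\<close>

text \<open>The penalty term vanishes when a function is compared with itself and is nonnegative
  otherwise, so dropping it can only lower the left side.\<close>

lemma step_minimizing_Dir_le:
  assumes min: "step_minimizing \<xi> f0 h f"
    and f0: "f0 \<in> Y2_tuples \<xi> (cball 0 1)" "strictly_defined (cball 0 1) (\<xi> \<circ> f0)"
  shows "Dir \<xi> (f k) (cball 0 1) \<le> Dir \<xi> f0 (cball 0 1)"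
proof -
  have step: "f (Suc k) \<in> competitors \<xi> f0 \<and> (\<forall>g\<in>competitors \<xi> f0.
      step_functional \<xi> h (Suc k) (f k) (f (Suc k)) \<le> step_functional \<xi> h (Suc k) (f k) g)" for k
    using min[unfolded step_minimizing_def, THEN conjunct2, THEN spec[where x = "Suc k"]] by simp
  have f: "f 0 = f0" "\<And>k. f (Suc k) \<in> competitors \<xi> f0"
    using min step by (simp_all add: step_minimizing_def)
  have le: "step_functional \<xi> h (Suc k) (f k) (f (Suc k)) \<le> step_functional \<xi> h (Suc k) (f k) g"
    if "g \<in> competitors \<xi> f0" for k g
    using step that by blast
  \<comment> \<open>Membership of \<open>f 1\<close> among the competitors provides a boundary value
    \<open>g\<close> of \<open>f0\<close>; this makes \<open>f0\<close> itself a competitor.\<close>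
  have "f0 \<in> competitors \<xi> f0"
    using f(2)[of 0] f0 unfolding competitors_def by blast
  then have comp: "f k \<in> competitors \<xi> f0" for k using f by (cases k) simp_all
  have self: "step_functional \<xi> h k g g = Dir \<xi> g (cball 0 1)" for k g
    by (simp add: step_functional_def l2_norm_sq_def)
  have "Dir \<xi> (f (Suc k)) (cball 0 1) \<le> Dir \<xi> (f k) (cball 0 1)" for k
  proof -
    have "Dir \<xi> (f (Suc k)) (cball 0 1) \<le> step_functional \<xi> h (Suc k) (f k) (f (Suc k))"
      by (simp add: step_functional_def)
    also have "\<dots> \<le> Dir \<xi> (f k) (cball 0 1)" using le[OF comp, of k k] by (simp add: self)
    finally show ?thesis .
  qed
  then show ?thesis by (induction k) (use f(1) in \<open>auto intro: order_trans\<close>)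
qed

section \<open>Transition intervals of the interpolation\<close>

definition transition_times :: "real \<Rightarrow> real set" where
  "transition_times h = (\<Union>i. {real (Suc i) * h - h / 2 ^ Suc i .. real (Suc i) * h})"

lemma transition_times_sets: "transition_times h \<in> sets lborel"
  unfolding transition_times_def by (intro sets.countable_UN) auto

lemma emeasure_transition_times_le:
  assumes "h > 0"
  shows "emeasure lborel (transition_times h) \<le> ennreal h"
proof -
  let ?I = "\<lambda>i. {real (Suc i) * h - h / 2 ^ Suc i .. real (Suc i) * h}"
  have s: "(\<lambda>i. h / 2 ^ Suc i) sums h"
    using sums_mult[OF power_half_series, of h] by (simp add: field_simps power_one_over)
  have "emeasure lborel (transition_times h) \<le> (\<Sum>i. emeasure lborel (?I i))"
    unfolding transition_times_def by (intro emeasure_subadditive_countably) auto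
  also have "\<dots> = (\<Sum>i. ennreal (h / 2 ^ Suc i))"
    using assms by (intro suminf_cong) simp
  also have "\<dots> = ennreal (\<Sum>i. h / 2 ^ Suc i)"
    using assms s by (intro suminf_ennreal_eq[symmetric, THEN sym]) (auto simp: sums_iff)
  also have "(\<Sum>i. h / 2 ^ Suc i) = h" using s by (simp add: sums_iff)
  finally show ?thesis .
qed

lemma interpolation_eq_step:
  assumes F: "interpolation \<xi> \<rho> h f F" and h: "h > 0" and t: "t \<ge> 0" "t \<notin> transition_times h"
  shows "\<exists>i. \<forall>x\<in>cball 0 1. F (t, x) = f i x"
proof -
  \<comment> \<open>Counted from 0: \<open>t\<close> lies between \<open>i * h\<close> and
    \<open>(i + 1) * h\<close>, which is stage \<open>Suc i\<close> of the interpolation, and on the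
    constant part of that stage \<open>F\<close> equals \<open>f i\<close>.\<close>
  define i where "i = nat \<lfloor>t / h\<rfloor>"
  have "real i = of_int \<lfloor>t / h\<rfloor>" using t(1) h by (simp add: i_def)
  then have "real i \<le> t / h" "t / h < real (Suc i)" by linarith+
  then have "real i * h \<le> t" "t < real (Suc i) * h" using h by (simp_all add: field_simps)
  moreover have "t \<notin> {real (Suc i) * h - h / 2 ^ Suc i .. real (Suc i) * h}"
    using t(2) unfolding transition_times_def by blast
  ultimately have "t \<in> {(real (Suc i) - 1) * h .. real (Suc i) * h - h / 2 ^ Suc i}" by simp
  then have "F (t, x) = f i x" if "x \<in> cball 0 1" for x
    using F[unfolded interpolation_def, rule_format, of "Suc i" x] that by simp
  then show ?thesis by blast
qed

text \<open>A strictly increasing \<open>r\<close> satisfies \<open>k \<le> r k\<close>, so along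
  the subsequence the measures are still dominated by the geometric series of ratio 1/2, and
  Borel-Cantelli applies.\<close>

lemma AE_eventually_not_transition_time:
  assumes "strict_mono r"
  shows "AE t in lebesgue. \<forall>\<^sub>F k in sequentially. t \<notin> transition_times (1 / 2 ^ r k)"
proof -
  let ?B = "\<lambda>k. transition_times (1 / 2 ^ r k)"
  have le: "emeasure lborel (?B k) \<le> ennreal (1 / 2 ^ r k)" for k
    by (intro emeasure_transition_times_le) simp
  have "AE t in lborel. \<forall>\<^sub>F k in sequentially. t \<in> space lborel - ?B k"
  proof (rule borel_cantelli_AE1)
    show "emeasure lborel (?B k) < \<infinity>" for k using le[of k] by (auto intro: le_less_trans)
    show "summable (\<lambda>k. measure lborel (?B k))"
    proof (rule summable_comparison_test')
      show "summable (\<lambda>k. (1 / 2 :: real) ^ k)" by (rule summable_geometric) simp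
      fix k :: nat
      have "measure lborel (?B k) \<le> 1 / 2 ^ r k"
        unfolding measure_def using le[of k] by (intro enn2real_leI) auto
      also have "\<dots> \<le> (1 / 2) ^ k"
        using seq_suble[OF assms, of k] by (simp add: power_one_over frac_le)
      finally show "norm (measure lborel (?B k)) \<le> (1 / 2) ^ k" by simp
    qed
  qed (rule transition_times_sets)
  then show ?thesis by (intro AE_completion) simp
qed

theorem theorem6p2:
  fixes \<xi> :: "(real^'n) multiset \<Rightarrow> ('q::{finite,linorder}, 'n, 's::finite) coords"
    and \<rho> :: "('q, 'n, 's) coords \<Rightarrow> ('q, 'n, 's) coords"
    and f0 :: "real^'m \<Rightarrow> (real^'n) multiset"
    and f :: "real \<Rightarrow> nat \<Rightarrow> real^'m \<Rightarrow> (real^'n) multiset"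
    and Fh :: "real \<Rightarrow> real \<times> (real^'m) \<Rightarrow> (real^'n) multiset"
    and F :: "real \<times> (real^'m) \<Rightarrow> (real^'n) multiset"
    and r :: "nat \<Rightarrow> nat"
  assumes "white_embedding \<xi>"
    and "lipschitz_retraction \<xi> \<rho>"
    and "f0 \<in> Y2_tuples \<xi> (cball 0 1)"
    and "strictly_defined (cball 0 1) (\<xi> \<circ> f0)"
    and "Dir \<xi> f0 (cball 0 1) < \<infinity>"
    and "l2_norm_sq (cball 0 1) (\<xi> \<circ> f0) < \<infinity>"
    and "\<And>h. h > 0 \<Longrightarrow> step_minimizing \<xi> f0 h (f h)"
    and "\<And>h. h > 0 \<Longrightarrow> interpolation \<xi> \<rho> h (f h) (Fh h)"
    and "strict_mono r"
    and "\<And>t x. t \<ge> 0 \<Longrightarrow> x \<in> cball 0 1 \<Longrightarrow> F (t, x) \<in> tuples CARD('q)"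
    and "\<And>T. T > 0 \<Longrightarrow>
           weakly_converges ({0..T} \<times> cball 0 1) (\<lambda>k. \<xi> \<circ> Fh (1 / 2 ^ r k)) (\<xi> \<circ> F)"
  shows "AE t in lebesgue. t > 0 \<longrightarrow>
           Dir \<xi> (\<lambda>x. F (t, x)) (cball 0 1) \<le> Dir \<xi> f0 (cball 0 1)"
proof -
  let ?B = "cball 0 1 :: (real^'m) set" and ?c = "Dir \<xi> f0 (cball 0 1)"
  let ?u = "\<xi> \<circ> F" and ?U = "\<lambda>k. \<xi> \<circ> Fh (1 / 2 ^ r k)"
  have frontier: "negligible (S - interior S)" if "convex S" for S :: "'d::euclidean_space set"
    using negligible_convex_frontier[OF that]
    by (rule negligible_subset) (use closure_subset in \<open>auto simp: frontier_def\<close>)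
  \<comment> \<open>Weak convergence is given on bounded cylinders, and slicing uses finite measure,
    so the claim is proved on each interval from 0 to \<open>T\<close>.\<close>
  have "AE t in lebesgue. t \<in> {0<..<T} \<longrightarrow> dirichlet_integral ?B (\<lambda>x. ?u (t, x)) \<le> ?c" if T: "T > 0" for T
  proof (rule weak_limit_slice_energy_le[OF assms(11)[OF T]])
    show "{0..T} \<times> ?B \<in> lmeasurable"
      by (intro lmeasurable_compact compact_Times compact_Icc compact_cball)
    show "negligible ({0..T} \<times> ?B - interior ({0..T} \<times> ?B))"
      by (intro frontier convex_Times convex_real_interval convex_cball)
    show "interior ({0..T} \<times> ?B) = {0<..<T} \<times> interior ?B"
      by (simp add: interior_Times)
    show "{0<..<T} \<in> lmeasurable" by (intro lmeasurable_open) simp_all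
    show "?B \<in> sets lebesgue" by (intro sets_completionI_sets) simp
    show "negligible (?B - interior ?B)" by (intro frontier convex_cball)
    show "?c < \<infinity>" by (rule assms(5))
    show "AE t in lebesgue. t \<in> {0<..<T} \<longrightarrow>
        (\<forall>\<^sub>F k in sequentially. dirichlet_integral ?B (\<lambda>x. ?U k (t, x)) \<le> ?c)"
      using AE_eventually_not_transition_time[OF assms(9)]
    proof eventually_elim
      case (elim t)
      show ?case
      proof
        assume t: "t \<in> {0<..<T}"
        from elim show "\<forall>\<^sub>F k in sequentially. dirichlet_integral ?B (\<lambda>x. ?U k (t, x)) \<le> ?c"
        proof eventually_elim
          case (elim k)
          define h :: real where "h = 1 / 2 ^ r k"
          have h: "h > 0" by (simp add: h_def)
          have "0 \<le> t" "t \<notin> transition_times h" using t elim by (simp_all add: h_def)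
          from interpolation_eq_step[OF assms(8)[OF h] h this]
          obtain i where i: "\<forall>x\<in>?B. Fh h (t, x) = f h i x" by (rule exE)
          \<comment> \<open>The slice is known to coincide with a step on the ball only, which is
            enough for the energy.\<close>
          have "dirichlet_integral ?B (\<lambda>x. (\<xi> \<circ> Fh h) (t, x)) = Dir \<xi> (f h i) ?B"
            unfolding Dir_def by (rule dirichlet_integral_cong) (use i interior_subset in auto)
          also have "\<dots> \<le> ?c"
            by (rule step_minimizing_Dir_le[OF assms(7)[OF h] assms(3,4)])
          finally show ?case by (simp add: h_def)
        qed
      qed
    qed
  qed simp_all
  \<comment> \<open>Countably many intervals exhaust the positive times; \<open>Suc n\<close> keeps
    \<open>T\<close> positive also for \<open>n = 0\<close>.\<close>
  then have "AE t in lebesgue. \<forall>n. t \<in> {0<..<real (Suc n)} \<longrightarrow> dirichlet_integral ?B (\<lambda>x. ?u (t, x)) \<le> ?c"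
    unfolding AE_all_countable by (intro allI) simp
  then show ?thesis
  proof eventually_elim
    case (elim t)
    obtain n where "t < real n" using reals_Archimedean2 by blast
    then have "t < real (Suc n)" by simp
    then show ?case using elim by (auto simp: Dir_def comp_def)
  qed
qed

end
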